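(* Let $k$ be an algebraically closed field of characteristic $p>0$, let $n\geq 2$, let $\partial=\sum_{i=1}^n x_i^2\partial_{x_i}$ on $\mathbb{A}^n_k$, let $Y=\mathbb{A}^n/\partial=\operatorname{Spec}k[x_1,\dots,x_n]^\partial$ and let $\mathbf{0}\in Y$ be the image of the origin. Then the singularity $(\mathbf{0}\in Y)$ is never $F$-injective.
   Context: $k[x_1,\dots,x_n]^{\partial}=\ker\partial$. A Noetherian local ring $(R,\mathfrak{m})$ of characteristic $p$ is $F$-injective if the Frobenius action on $H^i_{\mathfrak{m}}(R)$ is injective for every $i$; the singularity $(\mathbf{0}\in Y)$ is $F$-injective if $\mathcal{O}_{Y,\mathbf{0}}$ is. *)

theory Defs
  imports
    "HOL-Algebra.Algebra"
    "HOL-Library.Poly_Mapping"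
    "HOL-Computational_Algebra.Polynomial"
begin

section \<open>Localization of a commutative ring\<close>

text \<open>The class of \<open>a/s\<close> in \<open>S\<inverse>R\<close>, as a set of pairs. The factor \<open>u\<close> is needed because
  \<open>R\<close> need not be a domain.\<close>

definition frac_class :: "('a, 'm) ring_scheme \<Rightarrow> 'a set \<Rightarrow> 'a \<Rightarrow> 'a \<Rightarrow> ('a \<times> 'a) set" where
  "frac_class R S a s =
     {(b, t). b \<in> carrier R \<and> t \<in> S \<and>
        (\<exists>u\<in>S. u \<otimes>\<^bsub>R\<^esub> ((a \<otimes>\<^bsub>R\<^esub> t) \<ominus>\<^bsub>R\<^esub> (b \<otimes>\<^bsub>R\<^esub> s)) = \<zero>\<^bsub>R\<^esub>)}"

text \<open>Operations are unions over all representatives; for a multiplicative set \<open>S\<close> every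
  choice of representatives contributes the same class.\<close>

definition localization :: "('a, 'm) ring_scheme \<Rightarrow> 'a set \<Rightarrow> ('a \<times> 'a) set ring" where
  "localization R S =
     \<lparr>carrier = {frac_class R S a s | a s. a \<in> carrier R \<and> s \<in> S},
      monoid.mult = (\<lambda>A B. \<Union>(a, s)\<in>A. \<Union>(b, t)\<in>B. frac_class R S (a \<otimes>\<^bsub>R\<^esub> b) (s \<otimes>\<^bsub>R\<^esub> t)),
      one = frac_class R S \<one>\<^bsub>R\<^esub> \<one>\<^bsub>R\<^esub>,
      ring.zero = frac_class R S \<zero>\<^bsub>R\<^esub> \<one>\<^bsub>R\<^esub>,
      ring.add = (\<lambda>A B. \<Union>(a, s)\<in>A. \<Union>(b, t)\<in>B.
               frac_class R S ((a \<otimes>\<^bsub>R\<^esub> t) \<oplus>\<^bsub>R\<^esub> (b \<otimes>\<^bsub>R\<^esub> s)) (s \<otimes>\<^bsub>R\<^esub> t))\<rparr>"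

text \<open>The natural map \<open>S\<inverse>R \<rightarrow> T\<inverse>R\<close>, \<open>a/s \<mapsto> a/s\<close>, for \<open>S \<subseteq> T\<close>; it only depends on \<open>T\<close>.\<close>

definition localization_map ::
    "('a, 'm) ring_scheme \<Rightarrow> 'a set \<Rightarrow> ('a \<times> 'a) set \<Rightarrow> ('a \<times> 'a) set" where
  "localization_map R T A = (\<Union>(a, s)\<in>A. frac_class R T a s)"

definition localization_at_prime :: "('a, 'm) ring_scheme \<Rightarrow> 'a set \<Rightarrow> ('a \<times> 'a) set ring" where
  "localization_at_prime R Q = localization R (carrier R - Q)"


section \<open>The Cech complex and local cohomology\<close>

text \<open>For \<open>J \<subseteq> {0..<r}\<close> the ring \<open>R\<^bsub>f\<^sub>J\<^esub>\<close>, \<open>f\<^sub>J = \<Prod>\<^bsub>j\<in>J\<^esub> f\<^sub>j\<close>, is realised as the localization at the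
  multiplicative set of all monomials in the \<open>f\<^sub>j\<close>, \<open>j \<in> J\<close>, rather than at the powers of \<open>f\<^sub>J\<close>.
  These are the same ring, and now the multiplicative sets increase with \<open>J\<close>.\<close>

definition cech_denoms :: "('a, 'm) ring_scheme \<Rightarrow> 'a list \<Rightarrow> nat set \<Rightarrow> 'a set" where
  "cech_denoms R fs J =
     {(\<Otimes>\<^bsub>R\<^esub>j\<in>J. (fs ! j) [^]\<^bsub>R\<^esub> e j) | e :: nat \<Rightarrow> nat. True}"

definition cech_ring :: "('a, 'm) ring_scheme \<Rightarrow> 'a list \<Rightarrow> nat set \<Rightarrow> ('a \<times> 'a) set ring" where
  "cech_ring R fs J = localization R (cech_denoms R fs J)"

definition cech_index :: "'a list \<Rightarrow> nat \<Rightarrow> nat set set" where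
  "cech_index fs i = {J. J \<subseteq> {..<length fs} \<and> card J = i}"

text \<open>\<open>C\<^sup>i = \<Prod>\<^bsub>|J| = i\<^esub> R\<^bsub>f\<^sub>J\<^esub>\<close>, so that \<open>C\<^sup>0 = R\<close>.\<close>

definition cech_group ::
    "('a, 'm) ring_scheme \<Rightarrow> 'a list \<Rightarrow> nat \<Rightarrow> (nat set \<Rightarrow> ('a \<times> 'a) set) monoid" where
  "cech_group R fs i = product_group (cech_index fs i) (\<lambda>J. add_monoid (cech_ring R fs J))"

text \<open>\<open>(d c)\<^sub>J = \<Sum>\<^bsub>j\<in>J\<^esub> (-1)\<^bsup>pos j\<^esup> c\<^bsub>J - {j}\<^esub>\<close>, where \<open>pos j\<close> is the position of \<open>j\<close> in the increasing
  enumeration of \<open>J\<close>, counted from \<open>0\<close>.\<close>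

definition cech_diff ::
    "('a, 'm) ring_scheme \<Rightarrow> 'a list \<Rightarrow> nat \<Rightarrow>
     (nat set \<Rightarrow> ('a \<times> 'a) set) \<Rightarrow> nat set \<Rightarrow> ('a \<times> 'a) set" where
  "cech_diff R fs i c =
     (\<lambda>J\<in>cech_index fs (Suc i).
        \<Oplus>\<^bsub>cech_ring R fs J\<^esub>j\<in>J.
          (let x = localization_map R (cech_denoms R fs J) (c (J - {j}))
           in if even (card {l\<in>J. l < j}) then x else \<ominus>\<^bsub>cech_ring R fs J\<^esub> x))"

definition cech_cocycles ::
    "('a, 'm) ring_scheme \<Rightarrow> 'a list \<Rightarrow> nat \<Rightarrow> (nat set \<Rightarrow> ('a \<times> 'a) set) monoid" where
  "cech_cocycles R fs i =
     (cech_group R fs i)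
       \<lparr>carrier := kernel (cech_group R fs i) (cech_group R fs (Suc i)) (cech_diff R fs i)\<rparr>"

fun cech_coboundaries ::
    "('a, 'm) ring_scheme \<Rightarrow> 'a list \<Rightarrow> nat \<Rightarrow> (nat set \<Rightarrow> ('a \<times> 'a) set) set" where
  "cech_coboundaries R fs 0 = {\<one>\<^bsub>cech_group R fs 0\<^esub>}"
| "cech_coboundaries R fs (Suc i) = cech_diff R fs i ` carrier (cech_group R fs i)"

text \<open>\<open>H\<^sup>i\<^sub>I(R)\<close>, where \<open>I\<close> is any ideal with the same radical as the ideal generated by \<open>fs\<close>.\<close>

definition local_cohomology ::
    "('a, 'm) ring_scheme \<Rightarrow> 'a list \<Rightarrow> nat \<Rightarrow> (nat set \<Rightarrow> ('a \<times> 'a) set) set monoid" where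
  "local_cohomology R fs i = cech_cocycles R fs i Mod cech_coboundaries R fs i"


section \<open>The Frobenius action and F-injectivity\<close>

definition cech_frobenius ::
    "nat \<Rightarrow> ('a, 'm) ring_scheme \<Rightarrow> 'a list \<Rightarrow> nat \<Rightarrow>
     (nat set \<Rightarrow> ('a \<times> 'a) set) \<Rightarrow> nat set \<Rightarrow> ('a \<times> 'a) set" where
  "cech_frobenius p R fs i c = (\<lambda>J\<in>cech_index fs i. c J [^]\<^bsub>cech_ring R fs J\<^esub> p)"

text \<open>The induced map \<open>[c] \<mapsto> [F c]\<close>, again as a union over all representatives \<open>c\<close> of a class.\<close>

definition frobenius_action ::
    "nat \<Rightarrow> ('a, 'm) ring_scheme \<Rightarrow> 'a list \<Rightarrow> nat \<Rightarrow>
     (nat set \<Rightarrow> ('a \<times> 'a) set) set \<Rightarrow> (nat set \<Rightarrow> ('a \<times> 'a) set) set" where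
  "frobenius_action p R fs i A =
     (\<Union>c\<in>A. cech_coboundaries R fs i #>\<^bsub>cech_cocycles R fs i\<^esub> cech_frobenius p R fs i c)"

definition radical_ideal :: "('a, 'm) ring_scheme \<Rightarrow> 'a set \<Rightarrow> 'a set" where
  "radical_ideal R I = {a \<in> carrier R. \<exists>n::nat. a [^]\<^bsub>R\<^esub> n \<in> I}"

text \<open>The maximal ideal of a local ring.\<close>

definition nonunits :: "('a, 'm) ring_scheme \<Rightarrow> 'a set" where
  "nonunits R = carrier R - Units R"

text \<open>For a Noetherian local ring \<open>R\<close> of characteristic \<open>p\<close>. The modules \<open>H\<^sup>i\<^sub>\<mm>(R)\<close> with their
  Frobenius actions do not depend on the sequence \<open>fs\<close> used to compute them (up to canonical
  isomorphism), so quantifying over all admissible sequences avoids choosing one.\<close>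

definition F_injective :: "nat \<Rightarrow> ('a, 'm) ring_scheme \<Rightarrow> bool" where
  "F_injective p R \<longleftrightarrow>
     (\<forall>fs. set fs \<subseteq> carrier R \<and> radical_ideal R (genideal R (set fs)) = nonunits R \<longrightarrow>
        (\<forall>i. inj_on (frobenius_action p R fs i) (carrier (local_cohomology R fs i))))"


section \<open>Polynomials and the quotient by a derivation\<close>

type_synonym 'k mpoly = "(nat \<Rightarrow>\<^sub>0 nat) \<Rightarrow>\<^sub>0 'k"

definition Var :: "nat \<Rightarrow> 'k::comm_ring_1 mpoly" where
  "Var i = Poly_Mapping.single (Poly_Mapping.single i 1) 1"

text \<open>\<open>k[x\<^sub>1, \<dots>, x\<^sub>n]\<close> inside the polynomials in the variables \<open>x\<^sub>0, x\<^sub>1, x\<^sub>2, \<dots>\<close>.\<close>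

definition poly_carrier :: "nat \<Rightarrow> 'k::comm_ring_1 mpoly set" where
  "poly_carrier n = {f. \<forall>m\<in>Poly_Mapping.keys f. Poly_Mapping.keys m \<subseteq> {1..n}}"

definition pderivative :: "nat \<Rightarrow> 'k::comm_ring_1 mpoly \<Rightarrow> 'k mpoly" where
  "pderivative i f =
     (\<Sum>m\<in>Poly_Mapping.keys f.
        Poly_Mapping.single (m - Poly_Mapping.single i 1)
          (of_nat (Poly_Mapping.lookup m i) * Poly_Mapping.lookup f m))"

definition poly_eval :: "(nat \<Rightarrow> 'k) \<Rightarrow> 'k::comm_ring_1 mpoly \<Rightarrow> 'k" where
  "poly_eval a f =
     (\<Sum>m\<in>Poly_Mapping.keys f.
        Poly_Mapping.lookup f m * (\<Prod>i\<in>Poly_Mapping.keys m. a i ^ Poly_Mapping.lookup m i))"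

definition square_derivation :: "nat \<Rightarrow> 'k::comm_ring_1 mpoly \<Rightarrow> 'k mpoly" where
  "square_derivation n f = (\<Sum>i\<in>{1..n}. (Var i)\<^sup>2 * pderivative i f)"

definition kernel_ring :: "nat \<Rightarrow> ('k::comm_ring_1 mpoly \<Rightarrow> 'k mpoly) \<Rightarrow> 'k mpoly ring" where
  "kernel_ring n D =
     \<lparr>carrier = {f \<in> poly_carrier n. D f = 0}, monoid.mult = (*), one = 1,
      ring.zero = 0, ring.add = (+)\<rparr>"

text \<open>The maximal ideal of the origin of \<open>\<bbbA>\<^sup>n\<close>. Its image in \<open>Spec (ker D)\<close> is its contraction.\<close>

definition origin_ideal :: "nat \<Rightarrow> 'k::comm_ring_1 mpoly set" where
  "origin_ideal n = {f \<in> poly_carrier n. poly_eval (\<lambda>_. 0) f = 0}"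

definition quotient_local_ring ::
    "nat \<Rightarrow> ('k::comm_ring_1 mpoly \<Rightarrow> 'k mpoly) \<Rightarrow> ('k mpoly \<times> 'k mpoly) set ring" where
  "quotient_local_ring n D =
     localization_at_prime (kernel_ring n D) (origin_ideal n \<inter> carrier (kernel_ring n D))"

end

theory Submission
  imports Defs "HOL-Computational_Algebra.Polynomial_Factorial"
begin

text \<open>Write \<open>R = ker \<partial>\<close>, and let \<open>A\<close> be its local ring at the origin. The derivation satisfies
  \<open>\<partial>(1/x\<^sub>i) = -1\<close>, so the differences \<open>1/x\<^sub>j - 1/x\<^sub>i\<close> are killed by \<open>\<partial>\<close>, although the \<open>1/x\<^sub>i\<close>
  themselves are not. Computing \<open>H\<^sup>2\<^sub>\<mm>(A)\<close> with the sequence \<open>x\<^sub>1\<^sup>p, \<dots>, x\<^sub>n\<^sup>p\<close>, these differences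
  form a 2-cocycle. Its \<open>p\<close>-th power is the coboundary of the family \<open>1/x\<^sub>i\<^sup>p\<close>, so Frobenius kills its
  class. The class itself is not zero: if \<open>1/x\<^sub>2 - 1/x\<^sub>1 = r\<^sub>2 - r\<^sub>1\<close> with
  \<open>r\<^sub>i \<in> A[1/x\<^sub>i\<^sup>p]\<close>, then \<open>g = 1/x\<^sub>1 - r\<^sub>1 = 1/x\<^sub>2 - r\<^sub>2\<close> has denominators prime to \<open>x\<^sub>2\<close> and also
  denominators prime to \<open>x\<^sub>1\<close>, hence is regular at the origin, while \<open>\<partial>g = -1\<close>. That is
  impossible because \<open>\<partial>\<close> maps everything into the square of the maximal ideal of the origin.

  The iterated localizations are handled through their embeddings into the field of rational
  functions \<open>K\<close>: the lemma \<open>field_embedding_localization\<close> transports an embedding of a ring to its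
  localizations, and after two applications the Cech differential becomes an alternating sum in \<open>K\<close>,
  where Frobenius is visibly additive. The cohomological part of the argument is
  \<open>second_cohomology_not_injective\<close>, the nonvanishing of the class rests on \<open>no_common_fraction\<close>, and
  \<open>radical_params\<close> shows that the \<open>x\<^sub>i\<^sup>p\<close> do compute cohomology with support in the
  maximal ideal.\<close>

section \<open>Rings embedded into a field and their localizations\<close>

text \<open>Equations in \<open>R\<close> become equations in a field, where the type-class automation applies.\<close>

locale field_embedding = cring R for R (structure) +
  fixes \<phi> :: "'a \<Rightarrow> 'f::field"
  assumes inj: "inj_on \<phi> (carrier R)"
    and hom_add: "\<lbrakk>x \<in> carrier R; y \<in> carrier R\<rbrakk> \<Longrightarrow> \<phi> (x \<oplus> y) = \<phi> x + \<phi> y"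
    and hom_mult: "\<lbrakk>x \<in> carrier R; y \<in> carrier R\<rbrakk> \<Longrightarrow> \<phi> (x \<otimes> y) = \<phi> x * \<phi> y"
    and hom_one: "\<phi> \<one> = 1"
begin

lemma eq_iff: "\<lbrakk>x \<in> carrier R; y \<in> carrier R\<rbrakk> \<Longrightarrow> x = y \<longleftrightarrow> \<phi> x = \<phi> y"
  using inj by (auto dest: inj_onD)

lemma hom_zero: "\<phi> \<zero> = 0"
  using hom_add[OF zero_closed zero_closed] by (metis add_cancel_right_right l_zero zero_closed)

lemma hom_uminus: "x \<in> carrier R \<Longrightarrow> \<phi> (\<ominus> x) = - \<phi> x"
  using hom_add[of x "\<ominus> x"] by (simp add: r_neg hom_zero add_eq_0_iff)

lemma hom_minus: "\<lbrakk>x \<in> carrier R; y \<in> carrier R\<rbrakk> \<Longrightarrow> \<phi> (x \<ominus> y) = \<phi> x - \<phi> y"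
  by (simp add: a_minus_def hom_add hom_uminus)

lemma hom_pow: "x \<in> carrier R \<Longrightarrow> \<phi> (x [^] (m::nat)) = \<phi> x ^ m"
  by (induction m) (simp_all add: hom_one hom_mult mult.commute)

lemma hom_finsum: "(\<And>x. x \<in> A \<Longrightarrow> g x \<in> carrier R) \<Longrightarrow> \<phi> (\<Oplus>x\<in>A. g x) = (\<Sum>x\<in>A. \<phi> (g x))"
  by (induction A rule: infinite_finite_induct) (simp_all add: hom_zero hom_add finsum_insert Pi_def)

lemma hom_finprod: "(\<And>x. x \<in> A \<Longrightarrow> g x \<in> carrier R) \<Longrightarrow> \<phi> (\<Otimes>x\<in>A. g x) = (\<Prod>x\<in>A. \<phi> (g x))"
  by (induction A rule: infinite_finite_induct) (simp_all add: hom_one hom_mult finprod_insert Pi_def)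

end

lemma field_embeddingI:
  fixes R (structure) and \<phi> :: "'a \<Rightarrow> 'f::field"
  assumes inj: "inj_on \<phi> (carrier R)"
    and closed: "\<zero> \<in> carrier R" "\<one> \<in> carrier R"
      "\<And>x y. \<lbrakk>x \<in> carrier R; y \<in> carrier R\<rbrakk> \<Longrightarrow> x \<oplus> y \<in> carrier R"
      "\<And>x y. \<lbrakk>x \<in> carrier R; y \<in> carrier R\<rbrakk> \<Longrightarrow> x \<otimes> y \<in> carrier R"
    and hom: "\<phi> \<zero> = 0" "\<phi> \<one> = 1"
      "\<And>x y. \<lbrakk>x \<in> carrier R; y \<in> carrier R\<rbrakk> \<Longrightarrow> \<phi> (x \<oplus> y) = \<phi> x + \<phi> y"
      "\<And>x y. \<lbrakk>x \<in> carrier R; y \<in> carrier R\<rbrakk> \<Longrightarrow> \<phi> (x \<otimes> y) = \<phi> x * \<phi> y"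
    and neg: "\<And>x. x \<in> carrier R \<Longrightarrow> \<exists>y\<in>carrier R. \<phi> y = - \<phi> x"
  shows "field_embedding R \<phi>"
proof -
  have eq: "x = y" if "x \<in> carrier R" "y \<in> carrier R" "\<phi> x = \<phi> y" for x y
    using inj that by (auto dest: inj_onD)
  have "abelian_group R"
  proof (rule abelian_groupI)
    fix x assume x: "x \<in> carrier R"
    then obtain y where y: "y \<in> carrier R" "\<phi> y = - \<phi> x" using neg by blast
    have "y \<oplus> x = \<zero>" by (rule eq) (simp_all add: x y closed hom)
    with y show "\<exists>y\<in>carrier R. y \<oplus> x = \<zero>" by blast
  qed (auto intro!: eq simp: closed hom algebra_simps)
  moreover have "Group.comm_monoid R"
    by (rule comm_monoidI) (auto intro!: eq simp: closed hom algebra_simps)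
  ultimately have "cring R"
    by (rule cringI) (auto intro!: eq simp: closed hom algebra_simps)
  then show ?thesis
    by (intro field_embedding.intro field_embedding_axioms.intro) (simp_all add: inj hom)
qed

text \<open>All representatives of a fraction class have the same value, so any one of them may be chosen.
  The function does not mention the multiplicative set: the value of a fraction is unchanged by the
  natural maps between localizations.\<close>

definition frac_val :: "('a \<Rightarrow> 'f::field) \<Rightarrow> ('a \<times> 'a) set \<Rightarrow> 'f" where
  "frac_val g U = (case SOME z. z \<in> U of (a, s) \<Rightarrow> g a / g s)"

locale embedded_localization = field_embedding +
  fixes S
  assumes subset: "S \<subseteq> carrier R" and zero_notin: "\<zero> \<notin> S"
    and one_in: "\<one> \<in> S" and mult_in: "\<lbrakk>s \<in> S; t \<in> S\<rbrakk> \<Longrightarrow> s \<otimes> t \<in> S"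
begin

lemma in_carrier: "s \<in> S \<Longrightarrow> s \<in> carrier R"
  using subset by blast

lemma denom_nonzero: "s \<in> S \<Longrightarrow> \<phi> s \<noteq> 0"
  using eq_iff[of s \<zero>] zero_notin in_carrier by (auto simp: hom_zero)

lemma frac_class_eq:
  assumes "a \<in> carrier R" "s \<in> S"
  shows "frac_class R S a s = {(b, t). b \<in> carrier R \<and> t \<in> S \<and> \<phi> b / \<phi> t = \<phi> a / \<phi> s}"
proof -
  have "(\<exists>u\<in>S. u \<otimes> ((a \<otimes> t) \<ominus> (b \<otimes> s)) = \<zero>) \<longleftrightarrow> \<phi> b / \<phi> t = \<phi> a / \<phi> s"
    if b: "b \<in> carrier R" and t: "t \<in> S" for b t
  proof -
    have "u \<otimes> ((a \<otimes> t) \<ominus> (b \<otimes> s)) = \<zero> \<longleftrightarrow> \<phi> b / \<phi> t = \<phi> a / \<phi> s" if "u \<in> S" for u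
      using assms b t that denom_nonzero[OF \<open>s \<in> S\<close>] denom_nonzero[OF t] denom_nonzero[OF that]
      by (subst eq_iff) (auto simp: hom_zero hom_mult hom_minus in_carrier frac_eq_eq)
    with one_in show ?thesis by blast
  qed
  then show ?thesis unfolding frac_class_def by auto
qed

lemma frac_val_eq:
  assumes "(a, s) \<in> U" "U \<in> carrier (localization R S)"
  shows "frac_val \<phi> U = \<phi> a / \<phi> s"
proof -
  obtain b t where bt: "b \<in> carrier R" "t \<in> S" and U: "U = frac_class R S b t"
    using assms by (auto simp: localization_def)
  have "\<phi> (fst z) / \<phi> (snd z) = \<phi> b / \<phi> t" if "z \<in> U" for z
    using that by (auto simp: U frac_class_eq bt)
  from this[OF someI[of "\<lambda>z. z \<in> U", OF assms(1)]] this[OF assms(1)] show ?thesis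
    by (simp add: frac_val_def case_prod_unfold)
qed

lemma frac_class_mem: "\<lbrakk>a \<in> carrier R; s \<in> S\<rbrakk> \<Longrightarrow> (a, s) \<in> frac_class R S a s"
  by (simp add: frac_class_eq)

lemma frac_class_carrier:
  "\<lbrakk>a \<in> carrier R; s \<in> S\<rbrakk> \<Longrightarrow> frac_class R S a s \<in> carrier (localization R S)"
  by (auto simp: localization_def)

lemma frac_val_class: "\<lbrakk>a \<in> carrier R; s \<in> S\<rbrakk> \<Longrightarrow> frac_val \<phi> (frac_class R S a s) = \<phi> a / \<phi> s"
  by (rule frac_val_eq) (simp_all add: frac_class_mem frac_class_carrier)

lemma localization_elem:
  assumes "U \<in> carrier (localization R S)"
  obtains a s where "a \<in> carrier R" "s \<in> S" "U = frac_class R S a s"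
  using assms by (auto simp: localization_def)

lemma frac_val_image:
  "frac_val \<phi> ` carrier (localization R S) = {\<phi> a / \<phi> s | a s. a \<in> carrier R \<and> s \<in> S}"
proof (intro equalityI subsetI)
  fix v assume "v \<in> frac_val \<phi> ` carrier (localization R S)"
  then obtain a s where "a \<in> carrier R" "s \<in> S" "v = \<phi> a / \<phi> s"
    by (auto elim!: localization_elem simp: frac_val_class)
  then show "v \<in> {\<phi> a / \<phi> s | a s. a \<in> carrier R \<and> s \<in> S}" by blast
next
  fix v assume "v \<in> {\<phi> a / \<phi> s | a s. a \<in> carrier R \<and> s \<in> S}"
  then show "v \<in> frac_val \<phi> ` carrier (localization R S)"
    by (auto intro!: rev_image_eqI[OF frac_class_carrier] simp: frac_val_class)
qed

text \<open>The operations on a localization are unions over representatives; such a union collapses to a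
  single class as soon as the summand depends on the value of the fraction only.\<close>

lemma union_representatives:
  assumes A: "A \<in> carrier (localization R S)"
    and eq: "\<And>a s. \<lbrakk>a \<in> carrier R; s \<in> S; \<phi> a / \<phi> s = frac_val \<phi> A\<rbrakk> \<Longrightarrow> h a s = V"
  shows "(\<Union>(a, s)\<in>A. h a s) = V"
proof -
  obtain a s where as: "a \<in> carrier R" "s \<in> S" "A = frac_class R S a s"
    using A by (rule localization_elem)
  then have "h b t = V" if "(b, t) \<in> A" for b t
    using that frac_val_eq[OF that A] by (intro eq) (auto simp: frac_class_eq)
  moreover have "(a, s) \<in> A" by (simp add: as frac_class_mem)
  ultimately show ?thesis by blast
qed

lemma union_representatives2:
  assumes A: "A \<in> carrier (localization R S)" and B: "B \<in> carrier (localization R S)"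
    and eq: "\<And>a s b t. \<lbrakk>a \<in> carrier R; s \<in> S; \<phi> a / \<phi> s = frac_val \<phi> A;
                  b \<in> carrier R; t \<in> S; \<phi> b / \<phi> t = frac_val \<phi> B\<rbrakk> \<Longrightarrow> h a s b t = V"
  shows "(\<Union>(a, s)\<in>A. \<Union>(b, t)\<in>B. h a s b t) = V"
  by (intro union_representatives A B eq)

lemma frac_class_cong:
  assumes "a \<in> carrier R" "s \<in> S" "b \<in> carrier R" "t \<in> S" "\<phi> a / \<phi> s = \<phi> b / \<phi> t"
  shows "frac_class R S a s = frac_class R S b t"
  using assms by (simp add: frac_class_eq)

lemma quotient_mult:
  assumes "a \<in> carrier R" "s \<in> S" "b \<in> carrier R" "t \<in> S"
  shows "\<phi> (a \<otimes> b) / \<phi> (s \<otimes> t) = \<phi> a / \<phi> s * (\<phi> b / \<phi> t)"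
  using assms by (simp add: hom_mult in_carrier)

lemma quotient_add:
  assumes "a \<in> carrier R" "s \<in> S" "b \<in> carrier R" "t \<in> S"
  shows "\<phi> ((a \<otimes> t) \<oplus> (b \<otimes> s)) / \<phi> (s \<otimes> t) = \<phi> a / \<phi> s + \<phi> b / \<phi> t"
  using assms by (simp add: hom_mult hom_add in_carrier denom_nonzero add_frac_eq)

lemma localization_mult:
  assumes "a \<in> carrier R" "s \<in> S" "b \<in> carrier R" "t \<in> S"
  shows "frac_class R S a s \<otimes>\<^bsub>localization R S\<^esub> frac_class R S b t = frac_class R S (a \<otimes> b) (s \<otimes> t)"
proof -
  have "(\<Union>(a', s')\<in>frac_class R S a s. \<Union>(b', t')\<in>frac_class R S b t. frac_class R S (a' \<otimes> b') (s' \<otimes> t'))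
      = frac_class R S (a \<otimes> b) (s \<otimes> t)"
  proof (rule union_representatives2)
    fix a' s' b' t'
    assume *: "a' \<in> carrier R" "s' \<in> S" "\<phi> a' / \<phi> s' = frac_val \<phi> (frac_class R S a s)"
      "b' \<in> carrier R" "t' \<in> S" "\<phi> b' / \<phi> t' = frac_val \<phi> (frac_class R S b t)"
    then show "frac_class R S (a' \<otimes> b') (s' \<otimes> t') = frac_class R S (a \<otimes> b) (s \<otimes> t)"
      using assms by (intro frac_class_cong) (simp_all add: mult_in quotient_mult frac_val_class)
  qed (simp_all add: assms frac_class_carrier)
  then show ?thesis by (simp add: localization_def)
qed

lemma localization_add:
  assumes "a \<in> carrier R" "s \<in> S" "b \<in> carrier R" "t \<in> S"
  shows "frac_class R S a s \<oplus>\<^bsub>localization R S\<^esub> frac_class R S b t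
       = frac_class R S ((a \<otimes> t) \<oplus> (b \<otimes> s)) (s \<otimes> t)"
proof -
  have "(\<Union>(a', s')\<in>frac_class R S a s. \<Union>(b', t')\<in>frac_class R S b t.
          frac_class R S ((a' \<otimes> t') \<oplus> (b' \<otimes> s')) (s' \<otimes> t'))
      = frac_class R S ((a \<otimes> t) \<oplus> (b \<otimes> s)) (s \<otimes> t)"
  proof (rule union_representatives2)
    fix a' s' b' t'
    assume *: "a' \<in> carrier R" "s' \<in> S" "\<phi> a' / \<phi> s' = frac_val \<phi> (frac_class R S a s)"
      "b' \<in> carrier R" "t' \<in> S" "\<phi> b' / \<phi> t' = frac_val \<phi> (frac_class R S b t)"
    then show "frac_class R S ((a' \<otimes> t') \<oplus> (b' \<otimes> s')) (s' \<otimes> t')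
             = frac_class R S ((a \<otimes> t) \<oplus> (b \<otimes> s)) (s \<otimes> t)"
      using assms by (intro frac_class_cong) (simp_all add: mult_in in_carrier quotient_add frac_val_class)
  qed (simp_all add: assms frac_class_carrier)
  then show ?thesis by (simp add: localization_def)
qed

lemma field_embedding_localization: "field_embedding (localization R S) (frac_val \<phi>)"
proof (rule field_embeddingI)
  show "inj_on (frac_val \<phi>) (carrier (localization R S))"
    by (rule inj_onI) (metis frac_class_cong frac_val_class localization_elem)
  have zero: "\<zero>\<^bsub>localization R S\<^esub> = frac_class R S \<zero> \<one>"
    and one: "\<one>\<^bsub>localization R S\<^esub> = frac_class R S \<one> \<one>"
    by (simp_all add: localization_def)
  show "\<zero>\<^bsub>localization R S\<^esub> \<in> carrier (localization R S)" "\<one>\<^bsub>localization R S\<^esub> \<in> carrier (localization R S)"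
    "frac_val \<phi> \<zero>\<^bsub>localization R S\<^esub> = 0" "frac_val \<phi> \<one>\<^bsub>localization R S\<^esub> = 1"
    by (simp_all add: zero one frac_class_carrier frac_val_class one_in hom_zero hom_one)
  fix U V assume U: "U \<in> carrier (localization R S)" and V: "V \<in> carrier (localization R S)"
  obtain a s b t where as: "a \<in> carrier R" "s \<in> S" "U = frac_class R S a s"
    and bt: "b \<in> carrier R" "t \<in> S" "V = frac_class R S b t"
    using U V by (metis localization_elem)
  show "U \<oplus>\<^bsub>localization R S\<^esub> V \<in> carrier (localization R S)"
    "U \<otimes>\<^bsub>localization R S\<^esub> V \<in> carrier (localization R S)"
    "frac_val \<phi> (U \<otimes>\<^bsub>localization R S\<^esub> V) = frac_val \<phi> U * frac_val \<phi> V"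
    "frac_val \<phi> (U \<oplus>\<^bsub>localization R S\<^esub> V) = frac_val \<phi> U + frac_val \<phi> V"
    using as bt
    by (simp_all add: localization_add localization_mult frac_class_carrier frac_val_class
        mult_in in_carrier quotient_add quotient_mult)
  show "\<exists>V\<in>carrier (localization R S). frac_val \<phi> V = - frac_val \<phi> U"
    using as frac_class_carrier[of "\<ominus> a" s]
    by (intro bexI[of _ "frac_class R S (\<ominus> a) s"]) (simp_all add: frac_val_class hom_uminus)
qed

end

lemma frac_val_localization_map:
  assumes S: "embedded_localization R \<phi> S" and T: "embedded_localization R \<phi> T" and "S \<subseteq> T"
    and U: "U \<in> carrier (localization R S)"
  shows "localization_map R T U \<in> carrier (localization R T)"
    and "frac_val \<phi> (localization_map R T U) = frac_val \<phi> U"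
proof -
  interpret S: embedded_localization R \<phi> S by fact
  interpret T: embedded_localization R \<phi> T by fact
  obtain a s where as: "a \<in> carrier R" "s \<in> S" "U = frac_class R S a s"
    using U by (rule S.localization_elem)
  have "localization_map R T U = frac_class R T a s"
    unfolding localization_map_def
  proof (rule S.union_representatives[OF U])
    fix b t assume "b \<in> carrier R" "t \<in> S" "\<phi> b / \<phi> t = frac_val \<phi> U"
    then show "frac_class R T b t = frac_class R T a s"
      using as \<open>S \<subseteq> T\<close> by (intro T.frac_class_cong) (auto simp: S.frac_val_class)
  qed
  then show "localization_map R T U \<in> carrier (localization R T)"
    and "frac_val \<phi> (localization_map R T U) = frac_val \<phi> U"
    using as \<open>S \<subseteq> T\<close> by (auto simp: T.frac_class_carrier T.frac_val_class S.frac_val_class subsetD)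
qed


section \<open>The Cech complex inside a field\<close>

locale cech_embedding = field_embedding +
  fixes fs
  assumes fs_carrier: "set fs \<subseteq> carrier R" and fs_nonzero: "\<zero> \<notin> set fs"
begin

abbreviation "val \<equiv> frac_val \<phi>"

abbreviation "cech_vals J \<equiv> val ` carrier (cech_ring R fs J)"

lemma fs_nth: "j < length fs \<Longrightarrow> fs ! j \<in> carrier R" "j < length fs \<Longrightarrow> \<phi> (fs ! j) \<noteq> 0"
proof -
  assume j: "j < length fs"
  then show "fs ! j \<in> carrier R" using fs_carrier by auto
  moreover have "fs ! j \<noteq> \<zero>" using nth_mem[OF j] fs_nonzero by metis
  ultimately show "\<phi> (fs ! j) \<noteq> 0" using eq_iff[of "fs ! j" \<zero>] by (simp add: hom_zero)
qed

lemma hom_monomial: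
  assumes "J \<subseteq> {..<length fs}"
  shows "\<phi> (\<Otimes>j\<in>J. (fs ! j) [^] (e j :: nat)) = (\<Prod>j\<in>J. \<phi> (fs ! j) ^ e j)"
  using assms by (subst hom_finprod) (auto simp: hom_pow fs_nth intro!: prod.cong)

text \<open>A monomial in the \<open>f\<^sub>j\<close>, \<open>j \<in> I\<close>, is one in the \<open>f\<^sub>j\<close>, \<open>j \<in> J\<close>, with exponent \<open>0\<close> outside \<open>I\<close>.\<close>

lemma cech_denoms_mono:
  assumes "I \<subseteq> J" "J \<subseteq> {..<length fs}"
  shows "cech_denoms R fs I \<subseteq> cech_denoms R fs J"
proof
  fix s assume "s \<in> cech_denoms R fs I"
  then obtain e :: "nat \<Rightarrow> nat" where s: "s = (\<Otimes>j\<in>I. (fs ! j) [^] e j)"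
    by (auto simp: cech_denoms_def)
  have "s = (\<Otimes>j\<in>J. (fs ! j) [^] (if j \<in> I then e j else 0))"
    unfolding s using assms finite_subset[OF assms(2)]
    by (intro finprod_mono_neutral_cong_left) (auto simp: fs_nth subset_iff)
  then show "s \<in> cech_denoms R fs J"
    unfolding cech_denoms_def by (auto intro!: exI[of _ "\<lambda>j. if j \<in> I then e j else 0"])
qed

lemma embedded_localization_cech:
  assumes J: "J \<subseteq> {..<length fs}"
  shows "embedded_localization R \<phi> (cech_denoms R fs J)"
proof (intro embedded_localization.intro embedded_localization_axioms.intro)
  show "field_embedding R \<phi>" by (rule field_embedding_axioms)
  show "cech_denoms R fs J \<subseteq> carrier R"
    using J by (auto simp: cech_denoms_def fs_nth intro!: finprod_closed)
  have "\<phi> s \<noteq> 0" if "s \<in> cech_denoms R fs J" for s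
  proof -
    obtain e :: "nat \<Rightarrow> nat" where "s = (\<Otimes>j\<in>J. (fs ! j) [^] e j)"
      using \<open>s \<in> _\<close> by (auto simp: cech_denoms_def)
    then have "\<phi> s = (\<Prod>j\<in>J. \<phi> (fs ! j) ^ e j)" by (simp add: hom_monomial[OF J])
    moreover have "\<forall>j\<in>J. \<phi> (fs ! j) \<noteq> 0" using J fs_nth(2) by blast
    ultimately show ?thesis using finite_subset[OF J] by simp
  qed
  then show "\<zero> \<notin> cech_denoms R fs J" using hom_zero by auto
  show "\<one> \<in> cech_denoms R fs J"
    unfolding cech_denoms_def by (auto intro!: exI[of _ "\<lambda>_. 0"] finprod_one_eqI[symmetric])
  fix s t assume "s \<in> cech_denoms R fs J" "t \<in> cech_denoms R fs J"
  then obtain d e :: "nat \<Rightarrow> nat"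
    where "s = (\<Otimes>j\<in>J. (fs ! j) [^] d j)" "t = (\<Otimes>j\<in>J. (fs ! j) [^] e j)"
    by (auto simp: cech_denoms_def)
  then have "s \<otimes> t = (\<Otimes>j\<in>J. (fs ! j) [^] d j \<otimes> (fs ! j) [^] e j)"
    using J by (auto simp: fs_nth subset_iff intro!: finprod_multf[symmetric])
  also have "\<dots> = (\<Otimes>j\<in>J. (fs ! j) [^] (d j + e j))"
    using J by (intro finprod_cong') (auto simp: fs_nth nat_pow_mult)
  finally show "s \<otimes> t \<in> cech_denoms R fs J"
    unfolding cech_denoms_def by (auto intro!: exI[of _ "\<lambda>j. d j + e j"])
qed

lemma field_embedding_cech: "J \<subseteq> {..<length fs} \<Longrightarrow> field_embedding (cech_ring R fs J) val"
  unfolding cech_ring_def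
  by (rule embedded_localization.field_embedding_localization) (rule embedded_localization_cech)

lemma cech_vals_eq:
  assumes J: "J \<subseteq> {..<length fs}"
  shows "cech_vals J = {\<phi> a / (\<Prod>j\<in>J. \<phi> (fs ! j) ^ e j) | a e. a \<in> carrier R}"
  unfolding cech_ring_def embedded_localization.frac_val_image[OF embedded_localization_cech[OF J]]
  unfolding cech_denoms_def using hom_monomial[OF J] by auto metis+

lemma cech_index_subset: "J \<in> cech_index fs i \<Longrightarrow> J \<subseteq> {..<length fs}"
  by (simp add: cech_index_def)

lemma cech_index_remove:
  assumes "J \<in> cech_index fs (Suc i)" "j \<in> J"
  shows "J - {j} \<in> cech_index fs i"
  using assms finite_subset[OF cech_index_subset[OF assms(1)]] by (auto simp: cech_index_def)

lemma cochain_carrier: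
  "\<lbrakk>c \<in> carrier (cech_group R fs i); J \<in> cech_index fs i\<rbrakk> \<Longrightarrow> c J \<in> carrier (cech_ring R fs J)"
  by (auto simp: cech_group_def)

lemma cochain_eqI:
  assumes "c \<in> carrier (cech_group R fs i)" "c' \<in> carrier (cech_group R fs i)"
    and "\<And>J. J \<in> cech_index fs i \<Longrightarrow> val (c J) = val (c' J)"
  shows "c = c'"
proof (rule PiE_ext)
  show "c \<in> (\<Pi>\<^sub>E J\<in>cech_index fs i. carrier (cech_ring R fs J))"
    and "c' \<in> (\<Pi>\<^sub>E J\<in>cech_index fs i. carrier (cech_ring R fs J))"
    using assms by (simp_all add: cech_group_def)
  fix J assume J: "J \<in> cech_index fs i"
  then interpret J: field_embedding "cech_ring R fs J" val
    by (intro field_embedding_cech cech_index_subset)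
  show "c J = c' J"
    using J assms by (subst J.eq_iff) (auto intro: cochain_carrier)
qed

lemma cochain_with_values:
  assumes "\<And>J. J \<in> cech_index fs i \<Longrightarrow> g J \<in> cech_vals J"
  shows "\<exists>c \<in> carrier (cech_group R fs i). \<forall>J \<in> cech_index fs i. val (c J) = g J"
proof
  let ?c = "\<lambda>J\<in>cech_index fs i. inv_into (carrier (cech_ring R fs J)) val (g J)"
  show "?c \<in> carrier (cech_group R fs i)"
    using assms by (auto simp: cech_group_def inv_into_into)
  show "\<forall>J \<in> cech_index fs i. val (?c J) = g J"
    using assms by (simp add: f_inv_into_f)
qed

lemma group_cech: "Group.group (cech_group R fs i)"
  unfolding cech_group_def
proof (rule product_group)
  fix J assume "J \<in> cech_index fs i"
  then interpret J: field_embedding "cech_ring R fs J" val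
    by (intro field_embedding_cech cech_index_subset)
  show "Group.group (add_monoid (cech_ring R fs J))" by (rule J.a_group)
qed

lemma cochain_mult_val:
  assumes "c \<in> carrier (cech_group R fs i)" "c' \<in> carrier (cech_group R fs i)" "J \<in> cech_index fs i"
  shows "val ((c \<otimes>\<^bsub>cech_group R fs i\<^esub> c') J) = val (c J) + val (c' J)"
proof -
  interpret J: field_embedding "cech_ring R fs J" val
    using assms by (intro field_embedding_cech cech_index_subset)
  have "(c \<otimes>\<^bsub>cech_group R fs i\<^esub> c') J = c J \<oplus>\<^bsub>cech_ring R fs J\<^esub> c' J"
    using assms by (simp add: cech_group_def)
  then show ?thesis using assms by (simp add: J.hom_add cochain_carrier)
qed

lemma cochain_one_val:
  assumes "J \<in> cech_index fs i"
  shows "val (\<one>\<^bsub>cech_group R fs i\<^esub> J) = 0"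
proof -
  interpret J: field_embedding "cech_ring R fs J" val
    using assms by (intro field_embedding_cech cech_index_subset)
  show ?thesis using assms by (simp add: cech_group_def J.hom_zero)
qed

lemma cech_diff_closed_and_val:
  assumes c: "c \<in> carrier (cech_group R fs i)"
  shows cech_diff_closed: "cech_diff R fs i c \<in> carrier (cech_group R fs (Suc i))"
    and cech_diff_val: "J \<in> cech_index fs (Suc i) \<Longrightarrow>
      val (cech_diff R fs i c J) = (\<Sum>j\<in>J. (-1) ^ card {l\<in>J. l < j} * val (c (J - {j})))"
proof -
  have *: "cech_diff R fs i c J \<in> carrier (cech_ring R fs J)"
      "val (cech_diff R fs i c J) = (\<Sum>j\<in>J. (-1) ^ card {l\<in>J. l < j} * val (c (J - {j})))"
    if J: "J \<in> cech_index fs (Suc i)" for J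
  proof -
    have Jsub: "J \<subseteq> {..<length fs}" using J by (rule cech_index_subset)
    interpret J: field_embedding "cech_ring R fs J" val
      by (rule field_embedding_cech) fact
    define x where "x = (\<lambda>j. localization_map R (cech_denoms R fs J) (c (J - {j})))"
    have x: "x j \<in> carrier (cech_ring R fs J)" "val (x j) = val (c (J - {j}))" if "j \<in> J" for j
      using frac_val_localization_map[OF embedded_localization_cech[of "J - {j}"]
          embedded_localization_cech[OF Jsub] cech_denoms_mono[OF _ Jsub]]
        cochain_carrier[OF c cech_index_remove[OF J that]] Jsub
      by (auto simp: x_def cech_ring_def)
    have eq: "cech_diff R fs i c J = (\<Oplus>\<^bsub>cech_ring R fs J\<^esub>j\<in>J.
        if even (card {l\<in>J. l < j}) then x j else \<ominus>\<^bsub>cech_ring R fs J\<^esub> x j)"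
      unfolding cech_diff_def x_def Let_def using J by simp
    show "cech_diff R fs i c J \<in> carrier (cech_ring R fs J)"
      unfolding eq using x by (intro J.finsum_closed) auto
    show "val (cech_diff R fs i c J) = (\<Sum>j\<in>J. (-1) ^ card {l\<in>J. l < j} * val (c (J - {j})))"
      unfolding eq using x by (subst J.hom_finsum) (auto simp: J.hom_uminus intro!: sum.cong)
  qed
  show "cech_diff R fs i c \<in> carrier (cech_group R fs (Suc i))"
    using *(1) by (simp add: cech_group_def cech_diff_def PiE_iff)
  show "J \<in> cech_index fs (Suc i) \<Longrightarrow>
      val (cech_diff R fs i c J) = (\<Sum>j\<in>J. (-1) ^ card {l\<in>J. l < j} * val (c (J - {j})))"
    by (rule *(2))
qed

lemma cech_diff_hom: "group_hom (cech_group R fs i) (cech_group R fs (Suc i)) (cech_diff R fs i)"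
proof (intro group_hom.intro group_hom_axioms.intro homI group_cech cech_diff_closed)
  interpret C: Group.group "cech_group R fs i" by (rule group_cech)
  interpret C': Group.group "cech_group R fs (Suc i)" by (rule group_cech)
  fix c c' assume c: "c \<in> carrier (cech_group R fs i)" "c' \<in> carrier (cech_group R fs i)"
  show "cech_diff R fs i (c \<otimes>\<^bsub>cech_group R fs i\<^esub> c') =
      cech_diff R fs i c \<otimes>\<^bsub>cech_group R fs (Suc i)\<^esub> cech_diff R fs i c'"
    using c
    by (intro cochain_eqI)
       (auto simp: cech_diff_closed cech_diff_val cochain_mult_val cech_index_remove
         sum.distrib[symmetric] distrib_left intro!: sum.cong)
qed

end

locale cech_embedding_char = cech_embedding R \<phi> fs
  for R (structure) and \<phi> :: "'a \<Rightarrow> 'f::field" and fs +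
  fixes p :: nat
  assumes char: "CHAR('f) = p" and p_pos: "p > 0"
begin

lemma frobenius_closed_and_val:
  assumes c: "c \<in> carrier (cech_group R fs i)"
  shows frobenius_closed: "cech_frobenius p R fs i c \<in> carrier (cech_group R fs i)"
    and frobenius_val: "J \<in> cech_index fs i \<Longrightarrow> val (cech_frobenius p R fs i c J) = val (c J) ^ p"
proof -
  have *: "c J [^]\<^bsub>cech_ring R fs J\<^esub> p \<in> carrier (cech_ring R fs J)"
      "val (c J [^]\<^bsub>cech_ring R fs J\<^esub> p) = val (c J) ^ p" if J: "J \<in> cech_index fs i" for J
  proof -
    interpret J: field_embedding "cech_ring R fs J" val
      using J by (intro field_embedding_cech cech_index_subset)
    show "c J [^]\<^bsub>cech_ring R fs J\<^esub> p \<in> carrier (cech_ring R fs J)"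
      "val (c J [^]\<^bsub>cech_ring R fs J\<^esub> p) = val (c J) ^ p"
      using cochain_carrier[OF c J] by (simp_all add: J.hom_pow)
  qed
  show "cech_frobenius p R fs i c \<in> carrier (cech_group R fs i)"
    using * by (simp add: cech_group_def cech_frobenius_def)
  show "J \<in> cech_index fs i \<Longrightarrow> val (cech_frobenius p R fs i c J) = val (c J) ^ p"
    using * by (simp add: cech_frobenius_def)
qed

lemma power_p_add: "(x + y :: 'f) ^ p = x ^ p + y ^ p"
  using freshmans_dream[OF prime_CHAR_semidom] char p_pos by blast

lemma power_p_uminus: "(- x :: 'f) ^ p = - (x ^ p)"
  using minus_power_prime_CHAR[OF _ prime_CHAR_semidom] char p_pos by blast

lemma power_p_diff: "(x - y :: 'f) ^ p = x ^ p - y ^ p"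
  using power_p_add[of x "- y"] by (simp add: power_p_uminus)

lemma power_p_sum: "(\<Sum>x\<in>A. g x :: 'f) ^ p = (\<Sum>x\<in>A. g x ^ p)"
  using freshmans_dream_sum[OF prime_CHAR_semidom] char p_pos by blast

lemma power_p_sign: "((-1 :: 'f) ^ m) ^ p = (-1) ^ m"
  using power_p_uminus[of 1] by (metis power_commutes power_mult mult.commute power_one)

lemma frobenius_mult:
  assumes "c \<in> carrier (cech_group R fs i)" "c' \<in> carrier (cech_group R fs i)"
  shows "cech_frobenius p R fs i (c \<otimes>\<^bsub>cech_group R fs i\<^esub> c') =
    cech_frobenius p R fs i c \<otimes>\<^bsub>cech_group R fs i\<^esub> cech_frobenius p R fs i c'"
proof -
  interpret C: Group.group "cech_group R fs i" by (rule group_cech)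
  show ?thesis using assms
    by (intro cochain_eqI) (auto simp: frobenius_closed frobenius_val cochain_mult_val power_p_add)
qed

lemma frobenius_diff:
  assumes "c \<in> carrier (cech_group R fs i)"
  shows "cech_frobenius p R fs (Suc i) (cech_diff R fs i c) = cech_diff R fs i (cech_frobenius p R fs i c)"
  using assms
  by (intro cochain_eqI[where i = "Suc i"])
     (auto simp: frobenius_closed cech_diff_closed frobenius_val cech_diff_val cech_index_remove
        power_p_sum power_mult_distrib power_p_sign intro!: sum.cong)

text \<open>Frobenius commutes with the differential and so preserves coboundaries. It therefore sends the
  class of such a cocycle \<open>c\<close> and the zero class to the same coset.\<close>

lemma frobenius_not_injective:
  assumes c: "c \<in> carrier (cech_group R fs (Suc i))"
    and cocycle: "cech_diff R fs (Suc i) c = \<one>\<^bsub>cech_group R fs (Suc (Suc i))\<^esub>"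
    and nontrivial: "c \<notin> cech_coboundaries R fs (Suc i)"
    and killed: "cech_frobenius p R fs (Suc i) c \<in> cech_coboundaries R fs (Suc i)"
  shows "\<not> inj_on (frobenius_action p R fs (Suc i)) (carrier (local_cohomology R fs (Suc i)))"
proof
  define G where "G = cech_group R fs (Suc i)"
  define B where "B = cech_coboundaries R fs (Suc i)"
  define F where "F = cech_frobenius p R fs (Suc i)"
  assume inj_on: "inj_on (frobenius_action p R fs (Suc i)) (carrier (local_cohomology R fs (Suc i)))"
  interpret G: Group.group G unfolding G_def by (rule group_cech)
  interpret d: group_hom "cech_group R fs i" G "cech_diff R fs i"
    unfolding G_def by (rule cech_diff_hom)
  interpret d': group_hom G "cech_group R fs (Suc (Suc i))" "cech_diff R fs (Suc i)"
    unfolding G_def by (rule cech_diff_hom)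
  have B: "subgroup B G" unfolding B_def by (simp add: d.img_is_subgroup)
  have coset: "B #>\<^bsub>cech_cocycles R fs (Suc i)\<^esub> z = B #>\<^bsub>G\<^esub> z" for z
    by (simp add: r_coset_def cech_cocycles_def G_def)
  have FB: "F b \<in> B" if "b \<in> B" for b
    using that by (auto simp: F_def B_def frobenius_diff frobenius_closed)
  have action: "frobenius_action p R fs (Suc i) (B #>\<^bsub>G\<^esub> z) = B" if z: "z \<in> carrier G" "F z \<in> B" for z
  proof -
    have "B #>\<^bsub>G\<^esub> F y = B" if y: "y \<in> B #>\<^bsub>G\<^esub> z" for y
    proof -
      obtain b where b: "b \<in> B" "y = b \<otimes>\<^bsub>G\<^esub> z" using y by (auto simp: r_coset_def)
      then have "F y = F b \<otimes>\<^bsub>G\<^esub> F z"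
        using z subgroup.mem_carrier[OF B] by (simp add: F_def G_def frobenius_mult)
      then have "F y \<in> B" using b z FB subgroup.m_closed[OF B] by auto
      then show ?thesis using B by (intro G.coset_join2) (auto dest: subgroup.mem_carrier)
    qed
    moreover have "B #>\<^bsub>G\<^esub> z \<noteq> {}"
      using G.rcos_self[OF z(1) B] by blast
    ultimately have "(\<Union>y\<in>B #>\<^bsub>G\<^esub> z. B #>\<^bsub>G\<^esub> F y) = B" by blast
    then show ?thesis
      unfolding frobenius_action_def B_def[symmetric] F_def[symmetric] coset .
  qed
  have coset_in: "B #>\<^bsub>G\<^esub> z \<in> carrier (local_cohomology R fs (Suc i))"
    if "z \<in> carrier G" "cech_diff R fs (Suc i) z = \<one>\<^bsub>cech_group R fs (Suc (Suc i))\<^esub>" for z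
  proof -
    have "z \<in> carrier (cech_cocycles R fs (Suc i))"
      using that by (simp add: cech_cocycles_def kernel_def G_def)
    then have "B #>\<^bsub>cech_cocycles R fs (Suc i)\<^esub> z \<in> carrier (local_cohomology R fs (Suc i))"
      unfolding local_cohomology_def carrier_FactGroup B_def by (rule imageI)
    then show ?thesis by (simp only: coset)
  qed
  have c': "c \<in> carrier G" "F c \<in> B" "cech_diff R fs (Suc i) c = \<one>\<^bsub>cech_group R fs (Suc (Suc i))\<^esub>"
    using c killed cocycle by (simp_all only: G_def F_def B_def)
  have "B #>\<^bsub>G\<^esub> c = B #>\<^bsub>G\<^esub> \<one>\<^bsub>G\<^esub>"
  proof (rule inj_onD[OF inj_on])
    show "frobenius_action p R fs (Suc i) (B #>\<^bsub>G\<^esub> c)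
        = frobenius_action p R fs (Suc i) (B #>\<^bsub>G\<^esub> \<one>\<^bsub>G\<^esub>)"
      using action[OF c'(1,2)] action[OF G.one_closed FB[OF subgroup.one_closed[OF B]]] by metis
    show "B #>\<^bsub>G\<^esub> c \<in> carrier (local_cohomology R fs (Suc i))"
      using c'(1,3) by (rule coset_in)
    show "B #>\<^bsub>G\<^esub> \<one>\<^bsub>G\<^esub> \<in> carrier (local_cohomology R fs (Suc i))"
      using G.one_closed d'.hom_one by (rule coset_in)
  qed
  also have "\<dots> = B" using subgroup.subset[OF B] by (rule G.coset_mult_one)
  finally have "c \<in> B" using c'(1) B by (rule G.coset_join1)
  with nontrivial show False by (simp only: B_def)
qed

text \<open>The criterion for a 2-cocycle that is the formal coboundary of a family \<open>f\<close> of elements of the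
  field, which need not lie in the rings \<open>R\<^bsub>f\<^sub>i\<^esub>\<close>: the cocycle condition is then automatic, and the
  \<open>p\<close>-th powers of the family witness that Frobenius kills the class.\<close>

lemma second_cohomology_not_injective:
  fixes f :: "nat \<Rightarrow> 'f"
  assumes diff: "\<And>i j. \<lbrakk>i < j; j < length fs\<rbrakk> \<Longrightarrow> f j - f i \<in> cech_vals {i, j}"
    and power: "\<And>i. i < length fs \<Longrightarrow> f i ^ p \<in> cech_vals {i}"
    and nontrivial: "\<And>r. \<lbrakk>\<And>i. i < length fs \<Longrightarrow> r i \<in> cech_vals {i};
        \<And>i j. \<lbrakk>i < j; j < length fs\<rbrakk> \<Longrightarrow> f j - f i = r j - r i\<rbrakk> \<Longrightarrow> False"
  shows "\<not> inj_on (frobenius_action p R fs 2) (carrier (local_cohomology R fs 2))"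
proof -
  have index1: "\<exists>i < length fs. J = {i}" if "J \<in> cech_index fs (Suc 0)" for J
    using that by (auto simp: cech_index_def card_Suc_eq)
  have index1': "{i} \<in> cech_index fs (Suc 0)" if "i < length fs" for i
    using that by (auto simp: cech_index_def)
  have index2: "\<exists>i j. i < j \<and> j < length fs \<and> J = {i, j}" if "J \<in> cech_index fs (Suc (Suc 0))" for J
  proof -
    obtain x y where xy: "J = {x, y}" "x \<noteq> y"
      using \<open>J \<in> _\<close> by (auto simp: cech_index_def card_Suc_eq)
    then have "x < length fs" "y < length fs" using \<open>J \<in> _\<close> by (auto simp: cech_index_def)
    with xy show ?thesis by (metis insert_commute linorder_neqE_nat)
  qed
  have index2': "{i, j} \<in> cech_index fs (Suc (Suc 0))" if "i < j" "j < length fs" for i j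
    using that by (auto simp: cech_index_def)
  have index3: "\<exists>i j k. i < j \<and> j < k \<and> k < length fs \<and> J = {i, j, k}"
    if "J \<in> cech_index fs (Suc (Suc (Suc 0)))" for J
  proof -
    have J: "finite J" "J \<subseteq> {..<length fs}" "card J = 3"
      using that by (auto simp: cech_index_def finite_subset numeral_3_eq_3)
    define a where "a = Min J"
    define b where "b = Max J"
    have "J \<noteq> {}" using J by auto
    then have ab: "a \<in> J" "b \<in> J" "\<And>l. l \<in> J \<Longrightarrow> a \<le> l \<and> l \<le> b"
      using J(1) by (simp_all add: a_def b_def)
    have "card {a, b} \<le> 2" by (simp add: card_insert_if)
    then have "\<not> J \<subseteq> {a, b}" using J card_mono[of "{a, b}" J] by auto
    then obtain j where j: "j \<in> J" "j \<noteq> a" "j \<noteq> b" by blast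
    then have lt: "a < j" "j < b" using ab(3)[OF j(1)] by auto
    have "{a, j, b} = J"
    proof (rule card_subset_eq[OF J(1)])
      show "{a, j, b} \<subseteq> J" using ab j by blast
      show "card {a, j, b} = card J" using J(3) lt by simp
    qed
    moreover have "b < length fs" using ab(2) J(2) by blast
    ultimately show ?thesis using lt by blast
  qed
  have diff1: "val (cech_diff R fs (Suc 0) u {i, j}) = val (u {j}) - val (u {i})"
    if "u \<in> carrier (cech_group R fs (Suc 0))" "i < j" "j < length fs" for u i j
  proof -
    have sets: "{l. (l = i \<or> l = j) \<and> l < i} = {}" "{l. (l = i \<or> l = j) \<and> l < j} = {i}" "{i, j} - {i} = {j}" "{i, j} - {j} = {i}"
      using that by auto
    show ?thesis
      unfolding cech_diff_val[OF that(1) index2'[OF that(2,3)]] using that by (simp add: sets)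
  qed
  have "f (Max J) - f (Min J) \<in> cech_vals J" if "J \<in> cech_index fs (Suc (Suc 0))" for J
    using diff index2[OF that] by auto
  then obtain c where c: "c \<in> carrier (cech_group R fs (Suc (Suc 0)))"
    and c_val: "\<And>J. J \<in> cech_index fs (Suc (Suc 0)) \<Longrightarrow> val (c J) = f (Max J) - f (Min J)"
    using cochain_with_values[of "Suc (Suc 0)" "\<lambda>J. f (Max J) - f (Min J)"] by blast
  have c_val: "val (c {i, j}) = f j - f i" if "i < j" "j < length fs" for i j
    using that c_val[OF index2'[OF that]] by simp
  have "cech_diff R fs (Suc (Suc 0)) c = \<one>\<^bsub>cech_group R fs (Suc (Suc (Suc 0)))\<^esub>"
  proof (rule cochain_eqI[OF cech_diff_closed[OF c]])
    show "\<one>\<^bsub>cech_group R fs (Suc (Suc (Suc 0)))\<^esub> \<in> carrier (cech_group R fs (Suc (Suc (Suc 0))))"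
      using group_cech[of "Suc (Suc (Suc 0))"] by (simp add: Group.group.is_monoid)
    fix J assume J: "J \<in> cech_index fs (Suc (Suc (Suc 0)))"
    then obtain a b d where abd: "a < b" "b < d" "d < length fs" "J = {a, b, d}"
      using index3 by blast
    have sets: "{l. (l = a \<or> l = b \<or> l = d) \<and> l < a} = {}"
      "{l. (l = a \<or> l = b \<or> l = d) \<and> l < b} = {a}"
      "{l. (l = a \<or> l = b \<or> l = d) \<and> l < d} = {a, b}"
      "{a, b, d} - {a} = {b, d}" "{a, b, d} - {b} = {a, d}" "{a, b, d} - {d} = {a, b}"
      using abd by auto
    have "val (cech_diff R fs (Suc (Suc 0)) c J) = 0"
      unfolding cech_diff_val[OF c J] using abd by (simp add: sets c_val)
    then show "val (cech_diff R fs (Suc (Suc 0)) c J) = val (\<one>\<^bsub>cech_group R fs (Suc (Suc (Suc 0)))\<^esub> J)"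
      using cochain_one_val[OF J] by simp
  qed
  moreover have "c \<notin> cech_coboundaries R fs (Suc (Suc 0))"
  proof
    assume "c \<in> cech_coboundaries R fs (Suc (Suc 0))"
    then obtain u where u: "u \<in> carrier (cech_group R fs (Suc 0))" "c = cech_diff R fs (Suc 0) u"
      by auto
    show False
    proof (rule nontrivial[of "\<lambda>i. val (u {i})"])
      show "val (u {i}) \<in> cech_vals {i}" if "i < length fs" for i
        using u index1'[OF that] by (auto intro: cochain_carrier)
      show "f j - f i = val (u {j}) - val (u {i})" if "i < j" "j < length fs" for i j
        using c_val[OF that] diff1[OF u(1) that] u(2) by simp
    qed
  qed
  moreover have "cech_frobenius p R fs (Suc (Suc 0)) c \<in> cech_coboundaries R fs (Suc (Suc 0))"
  proof -
    have "f (Max J) ^ p \<in> cech_vals J" if "J \<in> cech_index fs (Suc 0)" for J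
      using power index1[OF that] by auto
    then obtain u where u: "u \<in> carrier (cech_group R fs (Suc 0))"
      and u_val: "\<And>J. J \<in> cech_index fs (Suc 0) \<Longrightarrow> val (u J) = f (Max J) ^ p"
      using cochain_with_values[of "Suc 0" "\<lambda>J. f (Max J) ^ p"] by blast
    have "cech_frobenius p R fs (Suc (Suc 0)) c = cech_diff R fs (Suc 0) u"
    proof (rule cochain_eqI[OF frobenius_closed[OF c] cech_diff_closed[OF u]])
      fix J assume J: "J \<in> cech_index fs (Suc (Suc 0))"
      then obtain i j where ij: "i < j" "j < length fs" "J = {i, j}" using index2 by blast
      then show "val (cech_frobenius p R fs (Suc (Suc 0)) c J) = val (cech_diff R fs (Suc 0) u J)"
        using frobenius_val[OF c J] diff1[OF u ij(1,2)] u_val[OF index1', of i] u_val[OF index1', of j]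
        by (simp add: c_val power_p_diff)
    qed
    with u show ?thesis by auto
  qed
  ultimately show ?thesis
    using frobenius_not_injective[OF c] by (simp add: numeral_2_eq_2)
qed

end


section \<open>Polynomials and the derivation\<close>

lemma mpoly_monomial_sum:
  fixes f :: "'k::comm_ring_1 mpoly"
  shows "f = (\<Sum>m\<in>Poly_Mapping.keys f. Poly_Mapping.single m (Poly_Mapping.lookup f m))"
  by (rule poly_mapping_eqI) (auto simp: lookup_sum lookup_single when_def in_keys_iff)

lemma mpoly_induct:
  fixes f :: "'k::comm_ring_1 mpoly"
  assumes "P 0" "\<And>m c. P (Poly_Mapping.single m c)" "\<And>f g. P f \<Longrightarrow> P g \<Longrightarrow> P (f + g)"
  shows "P f"
proof -
  have "P (\<Sum>m\<in>A. Poly_Mapping.single m (Poly_Mapping.lookup f m))" if "finite A" for A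
    using that by induction (simp_all add: assms)
  then show ?thesis by (subst mpoly_monomial_sum) simp
qed

lemma Var_power: "Var i ^ k = (Poly_Mapping.single (Poly_Mapping.single i k) 1 :: 'k::comm_ring_1 mpoly)"
  by (induction k) (simp_all add: Var_def mult_single single_add[symmetric])

lemma pderivative_superset:
  assumes "finite A" "Poly_Mapping.keys f \<subseteq> A"
  shows "pderivative i f = (\<Sum>m\<in>A. Poly_Mapping.single (m - Poly_Mapping.single i 1)
           (of_nat (Poly_Mapping.lookup m i) * Poly_Mapping.lookup f m))"
  unfolding pderivative_def
  by (rule sum.mono_neutral_left) (use assms in \<open>auto simp: in_keys_iff\<close>)

lemma pderivative_add: "pderivative i (f + g) = pderivative i f + pderivative i g"
proof -
  let ?A = "Poly_Mapping.keys f \<union> Poly_Mapping.keys g"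
  have "finite ?A" "Poly_Mapping.keys f \<subseteq> ?A" "Poly_Mapping.keys g \<subseteq> ?A" "Poly_Mapping.keys (f + g) \<subseteq> ?A"
    using keys_add[of f g] by auto
  then show ?thesis
    by (simp add: pderivative_superset[of ?A] lookup_add distrib_left single_add sum.distrib)
qed

lemma pderivative_single:
  "pderivative i (Poly_Mapping.single m c) =
     Poly_Mapping.single (m - Poly_Mapping.single i 1) (of_nat (Poly_Mapping.lookup m i) * c)"
  by (subst pderivative_superset[of "{m}"]) auto

lemma square_derivation_add:
  "square_derivation n (f + g) = square_derivation n f + square_derivation n g"
  by (simp add: square_derivation_def pderivative_add distrib_left sum.distrib)

lemma square_derivation_zero: "square_derivation n 0 = 0"
  using square_derivation_add[of n 0 0] by simp

lemma square_derivation_uminus: "square_derivation n (- f) = - square_derivation n f"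
  using square_derivation_add[of n f "- f"] by (simp add: square_derivation_zero eq_neg_iff_add_eq_0 add.commute)

lemma square_derivation_diff:
  "square_derivation n (f - g) = square_derivation n f - square_derivation n g"
  using square_derivation_add[of n f "- g"] by (simp add: square_derivation_uminus)

lemma square_derivation_sum: "square_derivation n (\<Sum>x\<in>A. h x) = (\<Sum>x\<in>A. square_derivation n (h x))"
  by (induction A rule: infinite_finite_induct) (simp_all add: square_derivation_zero square_derivation_add)

text \<open>The logarithmic derivative \<open>\<partial>(x\<^sup>m) / x\<^sup>m\<close> of a monomial under \<open>\<partial> = \<Sum> x\<^sub>i\<^sup>2 \<partial>\<^sub>i\<close>. It is a polynomial,
  and it is additive in \<open>m\<close>; this is the Leibniz rule on monomials.\<close>

definition log_derivative :: "nat \<Rightarrow> (nat \<Rightarrow>\<^sub>0 nat) \<Rightarrow> 'k::comm_ring_1 mpoly" where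
  "log_derivative n m = (\<Sum>i\<in>{1..n}. of_nat (Poly_Mapping.lookup m i) * Var i)"

lemma square_derivation_single:
  "square_derivation n (Poly_Mapping.single m c) = Poly_Mapping.single m c * log_derivative n m"
proof -
  have "(Var i)\<^sup>2 * pderivative i (Poly_Mapping.single m c)
      = Poly_Mapping.single m c * (of_nat (Poly_Mapping.lookup m i) * Var i)" for i
  proof (cases "Poly_Mapping.lookup m i = 0")
    case True
    then show ?thesis by (simp add: pderivative_single)
  next
    case False
    then have "Poly_Mapping.single i 2 + (m - Poly_Mapping.single i 1) = m + Poly_Mapping.single i 1"
      by (intro poly_mapping_eqI) (auto simp: lookup_add lookup_minus lookup_single when_def)
    then show ?thesis
      unfolding Var_power pderivative_single unfolding Var_def single_of_nat[symmetric] mult_single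
      by (simp only: add_0 mult_1 mult_1_right mult.commute[of c])
  qed
  then show ?thesis
    by (simp add: square_derivation_def log_derivative_def sum_distrib_left)
qed

lemma log_derivative_add: "log_derivative n (m + m') = log_derivative n m + log_derivative n m'"
  by (simp add: log_derivative_def lookup_add distrib_right sum.distrib)

lemma square_derivation_mult:
  "square_derivation n (f * g) = f * square_derivation n g + square_derivation n f * g"
proof (induction f rule: mpoly_induct)
  case (2 m c)
  show ?case
  proof (induction g rule: mpoly_induct)
    case (2 m' c')
    have "square_derivation n (Poly_Mapping.single m c * Poly_Mapping.single m' c')
        = Poly_Mapping.single m c * Poly_Mapping.single m' c' * (log_derivative n m + log_derivative n m')"
      by (simp only: mult_single square_derivation_single log_derivative_add)
    then show ?case by (simp only: square_derivation_single algebra_simps)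
  qed (simp_all add: square_derivation_zero square_derivation_add algebra_simps)
qed (simp_all add: square_derivation_zero square_derivation_add algebra_simps)

lemma square_derivation_power:
  "square_derivation n (f ^ k) = of_nat k * f ^ (k - 1) * square_derivation n f"
proof (induction k)
  case 0
  show ?case using square_derivation_mult[of n 1 1] by simp
next
  case (Suc k)
  then show ?case by (cases k) (simp_all add: square_derivation_mult algebra_simps)
qed

lemma square_derivation_Var:
  assumes "i \<in> {1..n}"
  shows "square_derivation n (Var i) = ((Var i)\<^sup>2 :: 'k::comm_ring_1 mpoly)"
proof -
  have "(log_derivative n (Poly_Mapping.single i 1) :: 'k mpoly) = (\<Sum>j\<in>{1..n}. if i = j then Var j else 0)"
    unfolding log_derivative_def by (intro sum.cong) (auto simp: lookup_single when_def)
  also have "\<dots> = Var i" using assms by simp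
  finally show ?thesis
    using square_derivation_single[of n "Poly_Mapping.single i 1" "1 :: 'k"]
    by (simp only: Var_def[symmetric] power2_eq_square)
qed

text \<open>The derivation sends \<open>x\<^sup>m\<close> to a combination of the \<open>x\<^sup>m x\<^sub>j\<close> with \<open>m\<^sub>j > 0\<close>, so the only
  monomial that contributes to \<open>x\<^sub>i\<^sup>k\<close> is \<open>x\<^sub>i\<^bsup>k-1\<^esup>\<close>, which \<open>x\<^sub>i\<^sup>k\<close> does not divide.\<close>

lemma lookup_square_derivation_pure_power:
  assumes "\<And>m. m \<in> Poly_Mapping.keys f \<Longrightarrow> k \<le> Poly_Mapping.lookup m i"
  shows "Poly_Mapping.lookup (square_derivation n f) (Poly_Mapping.single i k) = 0"
proof -
  have "Poly_Mapping.lookup (square_derivation n (Poly_Mapping.single m (Poly_Mapping.lookup f m)))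
          (Poly_Mapping.single i k) = 0" if m: "m \<in> Poly_Mapping.keys f" for m
  proof -
    have "m + Poly_Mapping.single j 1 = Poly_Mapping.single i k \<Longrightarrow> Poly_Mapping.lookup m j = 0" for j
      using assms[OF m] lookup_add[of m "Poly_Mapping.single j 1" i] lookup_add[of m "Poly_Mapping.single j 1" j]
      by (cases "i = j") (auto simp: lookup_single when_def)
    then show ?thesis
      unfolding square_derivation_single log_derivative_def sum_distrib_left lookup_sum
      by (intro sum.neutral) (auto simp: Var_def single_of_nat[symmetric] mult_single lookup_single when_def
           simp del: single_of_nat)
  qed
  then show ?thesis
    by (subst mpoly_monomial_sum) (simp add: square_derivation_sum lookup_sum)
qed

lemma lookup_mult_Var_power:
  "Poly_Mapping.lookup (f * Var i ^ k) (m + Poly_Mapping.single i k) = Poly_Mapping.lookup f m"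
  by (induction f rule: mpoly_induct)
     (simp_all add: Var_power mult_single lookup_single distrib_right lookup_add when_def)

lemma keys_mult_Var_power:
  assumes "m \<in> Poly_Mapping.keys (f * Var i ^ k)"
  shows "k \<le> Poly_Mapping.lookup m i"
proof -
  obtain m' where "m = m' + Poly_Mapping.single i k"
    using assms keys_mult[of f "Var i ^ k"] by (auto simp: Var_power split: if_splits)
  then show ?thesis by (simp add: lookup_add)
qed

text \<open>Unique factorization for two distinct variables, read off from exponents: \<open>x\<^sub>i\<^sup>k\<close> divides
  \<open>f x\<^sub>j\<^sup>l\<close>, hence every monomial of \<open>f\<close>.\<close>

lemma Var_power_divides_exponents:
  assumes eq: "f * Var j ^ l = g * Var i ^ k" and "i \<noteq> j" and m: "m \<in> Poly_Mapping.keys f"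
  shows "k \<le> Poly_Mapping.lookup m i"
proof -
  have "m + Poly_Mapping.single j l \<in> Poly_Mapping.keys (g * Var i ^ k)"
    using m by (simp add: in_keys_iff eq[symmetric] lookup_mult_Var_power)
  then show ?thesis
    using keys_mult_Var_power[of "m + Poly_Mapping.single j l" g i k] \<open>i \<noteq> j\<close>
    by (simp add: lookup_add lookup_single)
qed

lemma constant_term_mult:
  fixes f g :: "'k::comm_ring_1 mpoly"
  shows "Poly_Mapping.lookup (f * g) 0 = Poly_Mapping.lookup f 0 * Poly_Mapping.lookup g 0"
proof (induction f rule: mpoly_induct)
  case (2 m c)
  show ?case
  proof (induction g rule: mpoly_induct)
    case (2 m' c')
    have "m + m' = 0 \<longleftrightarrow> m = 0 \<and> m' = 0"
      by (auto simp: poly_mapping_eq_iff fun_eq_iff lookup_add)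
    then show ?case by (auto simp: mult_single lookup_single when_def)
  qed (simp_all add: distrib_left lookup_add)
qed (simp_all add: distrib_right lookup_add)

lemma constant_term_power: "Poly_Mapping.lookup (f ^ k :: 'k::comm_ring_1 mpoly) 0 = Poly_Mapping.lookup f 0 ^ k"
  by (induction k) (simp_all add: constant_term_mult)

lemma constant_term_Var: "Poly_Mapping.lookup (Var i) 0 = 0"
proof -
  have "Poly_Mapping.lookup (Poly_Mapping.single i (1 :: nat)) i \<noteq> Poly_Mapping.lookup 0 i" by simp
  then have "Poly_Mapping.single i (1 :: nat) \<noteq> 0" by metis
  then show ?thesis unfolding Var_def by (rule lookup_single_not_eq)
qed

lemma poly_eval_origin: "poly_eval (\<lambda>_. 0) f = Poly_Mapping.lookup f 0"
proof -
  have "(\<Prod>i\<in>Poly_Mapping.keys m. 0 ^ Poly_Mapping.lookup m i) = (if m = 0 then 1 else 0 :: 'a)" for m :: "nat \<Rightarrow>\<^sub>0 nat"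
    using keys_eq_empty[of m] by (auto simp: in_keys_iff power_0_left intro!: prod_zero)
  then have "poly_eval (\<lambda>_. 0) f = (\<Sum>m\<in>Poly_Mapping.keys f. if m = 0 then Poly_Mapping.lookup f m else 0)"
    unfolding poly_eval_def by (intro sum.cong) auto
  then show ?thesis by (simp add: in_keys_iff)
qed

lemma poly_carrier_single: "Poly_Mapping.keys m \<subseteq> {1..n} \<Longrightarrow> Poly_Mapping.single m c \<in> poly_carrier n"
  by (simp add: poly_carrier_def)

lemma poly_carrier_zero: "0 \<in> poly_carrier n"
  by (simp add: poly_carrier_def)

lemma poly_carrier_add: "f \<in> poly_carrier n \<Longrightarrow> g \<in> poly_carrier n \<Longrightarrow> f + g \<in> poly_carrier n"
  using keys_add[of f g] unfolding poly_carrier_def by blast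

lemma poly_carrier_uminus: "f \<in> poly_carrier n \<Longrightarrow> - f \<in> poly_carrier n"
  by (simp add: poly_carrier_def in_keys_iff)

lemma poly_carrier_mult: "f \<in> poly_carrier n \<Longrightarrow> g \<in> poly_carrier n \<Longrightarrow> f * g \<in> poly_carrier n"
proof -
  assume f: "f \<in> poly_carrier n" and g: "g \<in> poly_carrier n"
  have "Poly_Mapping.keys m \<subseteq> {1..n}" if m: "m \<in> Poly_Mapping.keys (f * g)" for m
  proof -
    obtain a b where "a \<in> Poly_Mapping.keys f" "b \<in> Poly_Mapping.keys g" "m = a + b"
      using m keys_mult[of f g] by blast
    then show ?thesis using f g keys_add[of a b] unfolding poly_carrier_def by blast
  qed
  then show ?thesis by (simp add: poly_carrier_def)
qed

lemma poly_carrier_one: "1 \<in> poly_carrier n"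
  using poly_carrier_single[of 0 n 1] by simp

lemma poly_carrier_power: "f \<in> poly_carrier n \<Longrightarrow> f ^ k \<in> poly_carrier n"
  by (induction k) (simp_all add: poly_carrier_one poly_carrier_mult)

lemma poly_carrier_Var: "i \<in> {1..n} \<Longrightarrow> Var i \<in> poly_carrier n"
  by (simp add: Var_def poly_carrier_single)

lemma CHAR_mpoly: "CHAR('k::comm_ring_1 mpoly) = CHAR('k)"
proof (rule CHAR_eqI)
  have *: "(of_nat k :: 'k mpoly) = 0 \<longleftrightarrow> (of_nat k :: 'k) = 0" for k
  proof
    assume "(of_nat k :: 'k mpoly) = 0"
    then have "Poly_Mapping.lookup (of_nat k :: 'k mpoly) 0 = 0" by simp
    then show "(of_nat k :: 'k) = 0" by (simp add: lookup_of_nat)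
  next
    assume "(of_nat k :: 'k) = 0"
    then show "(of_nat k :: 'k mpoly) = 0" by (metis single_of_nat single_zero)
  qed
  show "of_nat CHAR('k) = (0 :: 'k mpoly)" by (simp add: *)
  show "CHAR('k) dvd k" if "of_nat k = (0 :: 'k mpoly)" for k
    using that by (simp add: * of_nat_eq_0_iff_char_dvd)
qed

lemma to_fract_power: "to_fract (x ^ k) = to_fract x ^ k"
  by (induction k) simp_all

lemma to_fract_sum: "to_fract (\<Sum>x\<in>M. g x) = (\<Sum>x\<in>M. to_fract (g x))"
  by (induction M rule: infinite_finite_induct) simp_all

lemma CHAR_fract: "CHAR('r::idom fract) = CHAR('r)"
proof (rule CHAR_eqI)
  have *: "(of_nat k :: 'r fract) = 0 \<longleftrightarrow> (of_nat k :: 'r) = 0" for k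
    by (simp only: Fract_of_nat_eq[symmetric] to_fract_def[symmetric] to_fract_eq_0_iff)
  show "of_nat CHAR('r) = (0 :: 'r fract)" by (simp only: * of_nat_CHAR)
  show "CHAR('r) dvd k" if "of_nat k = (0 :: 'r fract)" for k
    using that by (simp only: * of_nat_eq_0_iff_char_dvd)
qed

text \<open>By the Freshman's Dream the \<open>p\<close>-th power of \<open>f\<close> is the sum of the \<open>p\<close>-th powers of its terms,
  and each term of a polynomial without constant term is divisible by some variable. This places
  \<open>f\<^sup>p\<close> in the ideal generated by the \<open>x\<^sub>i\<^sup>p\<close>, with coefficients that are \<open>p\<close>-th powers and thus invariant.\<close>

lemma mpoly_power_char_decomposition:
  fixes f :: "'k::idom mpoly"
  assumes char: "CHAR('k) = p" "p > 0" and f: "f \<in> poly_carrier n" "Poly_Mapping.lookup f 0 = 0"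
  obtains i h where "\<And>m. m \<in> Poly_Mapping.keys f \<Longrightarrow> i m \<in> {1..n} \<and> h m \<in> poly_carrier n"
    and "f ^ p = (\<Sum>m\<in>Poly_Mapping.keys f. h m ^ p * Var (i m) ^ p)"
proof -
  have ex: "\<exists>i h. i \<in> {1..n} \<and> h \<in> poly_carrier n \<and> Poly_Mapping.single m (Poly_Mapping.lookup f m) = h * Var i"
    if m: "m \<in> Poly_Mapping.keys f" for m
  proof -
    have "m \<noteq> 0" using m f(2) by (auto simp: in_keys_iff)
    then obtain i where i: "i \<in> Poly_Mapping.keys m" using keys_eq_empty[of m] by blast
    have keys: "Poly_Mapping.keys m \<subseteq> {1..n}" using f(1) m by (simp add: poly_carrier_def)
    define m' where "m' = m - Poly_Mapping.single i 1"
    have "m = m' + Poly_Mapping.single i 1"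
      using i unfolding m'_def
      by (intro poly_mapping_eqI) (auto simp: lookup_add lookup_minus lookup_single when_def in_keys_iff)
    moreover have "Poly_Mapping.keys m' \<subseteq> {1..n}"
      using keys by (auto simp: m'_def in_keys_iff lookup_minus subset_iff)
    ultimately show ?thesis
      using i keys
      by (intro exI[of _ i] exI[of _ "Poly_Mapping.single m' (Poly_Mapping.lookup f m)"])
         (auto simp: Var_def mult_single poly_carrier_single)
  qed
  then obtain i h where ih: "\<And>m. m \<in> Poly_Mapping.keys f \<Longrightarrow> i m \<in> {1..n} \<and> h m \<in> poly_carrier n \<and>
      Poly_Mapping.single m (Poly_Mapping.lookup f m) = h m * Var (i m)"
    by metis
  have "f ^ p = (\<Sum>m\<in>Poly_Mapping.keys f. Poly_Mapping.single m (Poly_Mapping.lookup f m)) ^ p"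
    by (rule arg_cong[OF mpoly_monomial_sum])
  also have "\<dots> = (\<Sum>m\<in>Poly_Mapping.keys f. Poly_Mapping.single m (Poly_Mapping.lookup f m) ^ p)"
    by (rule freshmans_dream_sum[OF prime_CHAR_semidom]) (simp_all add: CHAR_mpoly char)
  also have "\<dots> = (\<Sum>m\<in>Poly_Mapping.keys f. h m ^ p * Var (i m) ^ p)"
    using ih by (intro sum.cong refl) (simp only: power_mult_distrib)
  finally show ?thesis using that[of i h] ih by blast
qed


section \<open>The local ring of the quotient at the origin\<close>

abbreviation invariant_ring :: "nat \<Rightarrow> 'k::field mpoly ring" where
  "invariant_ring n \<equiv> kernel_ring n (square_derivation n)"

definition invariant_denoms :: "nat \<Rightarrow> 'k::field mpoly set" where
  "invariant_denoms n = {f \<in> carrier (invariant_ring n). Poly_Mapping.lookup f 0 \<noteq> 0}"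

lemma carrier_invariants: "carrier (invariant_ring n) = {f \<in> poly_carrier n. square_derivation n f = 0}"
  by (simp add: kernel_ring_def)

lemma quotient_local_ring_eq:
  "quotient_local_ring n (square_derivation n :: 'k::field mpoly \<Rightarrow> _) = localization (invariant_ring n) (invariant_denoms n)"
proof -
  have "carrier (invariant_ring n) - (origin_ideal n \<inter> carrier (invariant_ring n)) = (invariant_denoms n :: 'k mpoly set)"
    by (auto simp: invariant_denoms_def origin_ideal_def carrier_invariants poly_eval_origin)
  then show ?thesis by (simp add: quotient_local_ring_def localization_at_prime_def)
qed

lemma invariants_one: "1 \<in> carrier (invariant_ring n)"
  using square_derivation_mult[of n 1 1] by (simp add: carrier_invariants poly_carrier_one)

lemma invariants_mult:
  "f \<in> carrier (invariant_ring n) \<Longrightarrow> g \<in> carrier (invariant_ring n) \<Longrightarrow> f * g \<in> carrier (invariant_ring n)"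
  by (simp add: carrier_invariants poly_carrier_mult square_derivation_mult)

lemma field_embedding_invariants: "field_embedding (invariant_ring n :: 'k::field mpoly ring) to_fract"
proof (rule field_embeddingI)
  show "\<exists>g\<in>carrier (invariant_ring n). to_fract g = - to_fract f" if "f \<in> carrier (invariant_ring n)" for f :: "'k mpoly"
    using that by (intro bexI[of _ "- f"])
      (simp_all add: carrier_invariants poly_carrier_uminus square_derivation_uminus)
qed (use invariants_one[of n] in \<open>auto simp: kernel_ring_def inj_on_def poly_carrier_add poly_carrier_mult
    poly_carrier_zero square_derivation_add square_derivation_mult square_derivation_zero\<close>)

lemma embedded_localization_invariants:
  "embedded_localization (invariant_ring n :: 'k::field mpoly ring) to_fract (invariant_denoms n)"
proof (intro embedded_localization.intro embedded_localization_axioms.intro field_embedding_invariants)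
  show "s \<otimes>\<^bsub>invariant_ring n\<^esub> t \<in> invariant_denoms n"
    if "s \<in> invariant_denoms n" "t \<in> invariant_denoms n" for s t :: "'k mpoly"
    using that invariants_mult[of s n t] by (simp add: invariant_denoms_def kernel_ring_def constant_term_mult)
qed (use invariants_one[of n] in \<open>auto simp: invariant_denoms_def kernel_ring_def\<close>)

lemma char_power_invariant:
  fixes f :: "'k::field mpoly"
  assumes "CHAR('k) = p" "f \<in> poly_carrier n"
  shows "f ^ p \<in> carrier (invariant_ring n)"
proof -
  have "(of_nat p :: 'k mpoly) = 0"
    using of_nat_CHAR[where 'a = "'k mpoly"] by (simp add: CHAR_mpoly assms)
  then show ?thesis
    by (simp add: carrier_invariants poly_carrier_power assms square_derivation_power)
qed

text \<open>For \<open>p\<close> dividing \<open>N\<close> this is the identity \<open>\<partial>(1/x\<^sub>i) = -1\<close>, multiplied by the constant \<open>x\<^sub>i\<^sup>N\<close>.\<close>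

lemma square_derivation_Var_power_pred:
  assumes "i \<in> {1..n}" "(of_nat N :: 'k::field mpoly) = 0" "N > 0"
  shows "square_derivation n (Var i ^ (N - 1)) = (- (Var i ^ N) :: 'k mpoly)"
proof -
  obtain k where k: "N = Suc (Suc k)"
    using assms(2,3) by (cases N rule: nat.exhaust; cases "N - 1") auto
  have "(of_nat (N - 1) :: 'k mpoly) + 1 = 0"
    using assms(2) by (simp add: k algebra_simps)
  then have "(of_nat (N - 1) :: 'k mpoly) = - 1" by (simp only: eq_neg_iff_add_eq_0)
  then have "square_derivation n (Var i ^ (N - 1)) = (- 1 * Var i ^ (N - 1 - 1) * (Var i)\<^sup>2 :: 'k mpoly)"
    using square_derivation_power[of n "Var i :: 'k mpoly" "N - 1"] square_derivation_Var[OF assms(1), where 'k = 'k]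
    by simp
  also have "\<dots> = - (Var i ^ N)" by (simp add: k power2_eq_square mult_ac)
  finally show ?thesis .
qed

text \<open>The equation says \<open>1/x\<^sub>i - a/(s x\<^sub>i\<^sup>N) = 1/x\<^sub>j - b/(t x\<^sub>j\<^sup>M)\<close> with denominators cleared. It
  forces all monomials of \<open>w = (s x\<^sub>i\<^bsup>N-1\<^esup> - a) t\<close> to be divisible by \<open>x\<^sub>i\<^sup>N\<close>, so \<open>x\<^sub>i\<^sup>N\<close> cannot occur
  in \<open>\<partial>w\<close>. But \<open>\<partial>w = - s t x\<^sub>i\<^sup>N\<close>, where its coefficient is minus the constant term of \<open>s t\<close>.\<close>

lemma no_common_fraction:
  fixes s t a b :: "'k::field mpoly"
  assumes ij: "i \<in> {1..n}" "i \<noteq> j" and N: "(of_nat N :: 'k mpoly) = 0" "N > 0"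
    and inv: "square_derivation n s = 0" "square_derivation n t = 0" "square_derivation n a = 0"
    and eq: "(s * Var i ^ (N - 1) - a) * (t * Var j ^ M) = (t * Var j ^ (M - 1) - b) * (s * Var i ^ N)"
  shows "Poly_Mapping.lookup (s * t) 0 = 0"
proof -
  define w where "w = (s * Var i ^ (N - 1) - a) * t"
  have "w * Var j ^ M = ((t * Var j ^ (M - 1) - b) * s) * Var i ^ N"
    using eq by (simp add: w_def mult.assoc)
  then have "Poly_Mapping.lookup (square_derivation n w) (Poly_Mapping.single i N) = 0"
    by (intro lookup_square_derivation_pure_power Var_power_divides_exponents[OF _ ij(2)])
  moreover have "square_derivation n w = (- (s * t)) * Var i ^ N"
    unfolding w_def square_derivation_mult square_derivation_diff inv square_derivation_Var_power_pred[OF ij(1) N]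
    by (simp add: mult_ac)
  moreover have "Poly_Mapping.lookup ((- (s * t)) * Var i ^ N) (Poly_Mapping.single i N)
      = - Poly_Mapping.lookup (s * t) 0"
    using lookup_mult_Var_power[of "- (s * t)" i N 0] by simp
  ultimately show ?thesis by simp
qed

lemma clear_denominators:
  fixes x y s t a b :: "'f::field"
  assumes "x \<noteq> 0" "y \<noteq> 0" "s \<noteq> 0" "t \<noteq> 0" "N > 0" "M > 0"
    and eq: "1 / x - a / (s * x ^ N) = 1 / y - b / (t * y ^ M)"
  shows "(s * x ^ (N - 1) - a) * (t * y ^ M) = (t * y ^ (M - 1) - b) * (s * x ^ N)"
proof -
  have *: "1 / x - a / (s * x ^ N) = (s * x ^ (N - 1) - a) / (s * x ^ N)"
    if "x \<noteq> 0" "s \<noteq> 0" "N > 0" for x s a :: 'f and N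
    using that by (cases N) (simp_all add: field_simps)
  show ?thesis
    using eq assms unfolding *[OF assms(1,3,5)] *[OF assms(2,4,6)] by (subst (asm) frac_eq_eq) auto
qed

text \<open>The elements \<open>x\<^sub>1\<^sup>p/1, \<dots>, x\<^sub>n\<^sup>p/1\<close>; positions in the list start at \<open>0\<close>, variables at \<open>1\<close>.\<close>

definition frobenius_params :: "nat \<Rightarrow> nat \<Rightarrow> ('k::field mpoly \<times> 'k mpoly) set list" where
  "frobenius_params p n = map (\<lambda>i. frac_class (invariant_ring n) (invariant_denoms n) (Var (Suc i) ^ p) 1) [0..<n]"

context
  fixes n p :: nat and A :: "('k::field mpoly \<times> 'k mpoly) set ring"
    and fs :: "('k mpoly \<times> 'k mpoly) set list"
  assumes char: "CHAR('k) = p" and p_pos: "p > 0"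
  defines "A \<equiv> quotient_local_ring n (square_derivation n)"
    and "fs \<equiv> frobenius_params p n"
begin

interpretation L: embedded_localization "invariant_ring n :: 'k mpoly ring" to_fract "invariant_denoms n"
  by (rule embedded_localization_invariants)

lemma A_eq: "A = localization (invariant_ring n) (invariant_denoms n)"
  unfolding A_def by (rule quotient_local_ring_eq)

interpretation A: field_embedding A "frac_val to_fract"
  unfolding A_eq by (rule L.field_embedding_localization)

lemma one_denom: "(1 :: 'k mpoly) \<in> invariant_denoms n"
  using L.one_in by (simp add: kernel_ring_def)

lemma denomD: "s \<in> invariant_denoms n \<Longrightarrow> s \<in> carrier (invariant_ring n) \<and> Poly_Mapping.lookup s 0 \<noteq> 0 \<and> s \<noteq> 0"
  by (auto simp: invariant_denoms_def)

lemma A_fraction: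
  assumes "a \<in> carrier (invariant_ring n)" "s \<in> invariant_denoms n"
  obtains U where "U \<in> carrier A" "frac_val to_fract U = to_fract a / to_fract s"
  using L.frac_class_carrier[OF assms] L.frac_val_class[OF assms] that unfolding A_eq by blast

lemma A_elem:
  assumes "U \<in> carrier A"
  obtains a s where "a \<in> carrier (invariant_ring n)" "s \<in> invariant_denoms n" "frac_val to_fract U = to_fract a / to_fract s"
  using assms unfolding A_eq by (metis L.localization_elem L.frac_val_class)

lemma Var_power_invariant: "i \<in> {1..n} \<Longrightarrow> (Var i ^ p :: 'k mpoly) \<in> carrier (invariant_ring n)"
  by (intro char_power_invariant char poly_carrier_Var)

lemma length_fs: "length fs = n"
  by (simp add: fs_def frobenius_params_def)

lemma fs_nth_carrier: "i < n \<Longrightarrow> fs ! i \<in> carrier A"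
  unfolding A_eq fs_def frobenius_params_def
  by (simp add: L.frac_class_carrier one_denom Var_power_invariant)

lemma fs_nth_val: "i < n \<Longrightarrow> frac_val to_fract (fs ! i) = to_fract (Var (Suc i)) ^ p"
  unfolding fs_def frobenius_params_def
  by (simp add: L.frac_val_class one_denom Var_power_invariant to_fract_power)

lemma set_fs: "set fs = {fs ! i | i. i < n}"
  by (simp add: set_conv_nth length_fs)

lemma to_fract_Var_nonzero: "to_fract (Var i :: 'k mpoly) \<noteq> 0"
proof -
  have "Poly_Mapping.lookup (Var i :: 'k mpoly) (Poly_Mapping.single i 1) = 1" by (simp add: Var_def)
  then show ?thesis by force
qed

lemma cech_embedding_A: "cech_embedding_char A (frac_val to_fract) fs p"
proof (intro cech_embedding_char.intro cech_embedding.intro cech_embedding_axioms.intro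
    cech_embedding_char_axioms.intro)
  show "field_embedding A (frac_val to_fract)" by (rule A.field_embedding_axioms)
  show "set fs \<subseteq> carrier A" by (auto simp: set_fs fs_nth_carrier)
  have "frac_val to_fract U \<noteq> 0" if "U \<in> set fs" for U
    using that to_fract_Var_nonzero by (auto simp: set_fs fs_nth_val)
  then show "\<zero>\<^bsub>A\<^esub> \<notin> set fs" using A.hom_zero by auto
  show "CHAR('k mpoly fract) = p" by (simp add: CHAR_fract CHAR_mpoly char)
qed (rule p_pos)

interpretation C: cech_embedding_char A "frac_val to_fract" fs p
  by (rule cech_embedding_A)

text \<open>Fractions with a numerator vanishing at the origin form an ideal. It is proper and contains the
  parameters, which bounds the radical of the ideal they generate.\<close>

lemma ideal_of_maximal_ideal:
  "ideal {U \<in> carrier A. \<exists>a s. a \<in> carrier (invariant_ring n) \<and> s \<in> invariant_denoms n \<and>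
     Poly_Mapping.lookup a 0 = 0 \<and> frac_val to_fract U = to_fract a / to_fract s} A"
proof -
  define P where "P v \<longleftrightarrow> (\<exists>a s :: 'k mpoly. a \<in> carrier (invariant_ring n) \<and> s \<in> invariant_denoms n \<and>
     Poly_Mapping.lookup a 0 = 0 \<and> v = to_fract a / to_fract s)" for v
  have P_mult: "P (to_fract b / to_fract t * v)"
    if "P v" "b \<in> carrier (invariant_ring n)" "t \<in> invariant_denoms n" for v and b t :: "'k mpoly"
  proof -
    obtain a s :: "'k mpoly" where as: "a \<in> carrier (invariant_ring n)" "s \<in> invariant_denoms n"
      "Poly_Mapping.lookup a 0 = 0" "v = to_fract a / to_fract s"
      using \<open>P v\<close> unfolding P_def by blast
    have "b * a \<in> carrier (invariant_ring n)" "t * s \<in> invariant_denoms n"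
      using as that invariants_mult L.mult_in[of t s] by (auto simp: kernel_ring_def)
    moreover have "to_fract b / to_fract t * v = to_fract (b * a) / to_fract (t * s)" by (simp add: as)
    moreover have "Poly_Mapping.lookup (b * a) 0 = 0" by (simp add: constant_term_mult as)
    ultimately show ?thesis unfolding P_def by blast
  qed
  have P_add: "P (v + w)" if "P v" "P w" for v w
  proof -
    obtain a s :: "'k mpoly" where as: "a \<in> carrier (invariant_ring n)" "s \<in> invariant_denoms n"
      "Poly_Mapping.lookup a 0 = 0" "v = to_fract a / to_fract s"
      using \<open>P v\<close> unfolding P_def by blast
    obtain b t :: "'k mpoly" where bt: "b \<in> carrier (invariant_ring n)" "t \<in> invariant_denoms n"
      "Poly_Mapping.lookup b 0 = 0" "w = to_fract b / to_fract t"
      using \<open>P w\<close> unfolding P_def by blast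
    have "a * t + b * s \<in> carrier (invariant_ring n)" "s * t \<in> invariant_denoms n"
      using as bt invariants_mult[of a n t] invariants_mult[of b n s] denomD[of s] denomD[of t] L.mult_in[of s t]
      by (auto simp: kernel_ring_def square_derivation_add poly_carrier_add)
    moreover have "v + w = to_fract (a * t + b * s) / to_fract (s * t)"
      using as bt denomD[of s] denomD[of t] by (simp add: add_frac_eq)
    moreover have "Poly_Mapping.lookup (a * t + b * s) 0 = 0" by (simp add: lookup_add constant_term_mult as bt)
    ultimately show ?thesis unfolding P_def by blast
  qed
  have P_zero: "P 0"
    unfolding P_def using one_denom L.zero_closed
    by (intro exI[of _ 0] exI[of _ 1]) (auto simp: kernel_ring_def)
  have P_uminus: "P (- v)" if "P v" for v
  proof -
    have "- 1 \<in> carrier (invariant_ring n :: 'k mpoly ring)"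
      using invariants_one[of n, where 'a = 'k]
      by (simp add: carrier_invariants poly_carrier_uminus square_derivation_uminus)
    then show ?thesis using P_mult[OF that _ one_denom, of "- 1"] by simp
  qed
  have "ideal {U \<in> carrier A. P (frac_val to_fract U)} A"
  proof (rule idealI[OF A.ring_axioms])
    show "subgroup {U \<in> carrier A. P (frac_val to_fract U)} (add_monoid A)"
    proof (unfold_locales, goal_cases)
      case (4 U)
      then have "inv\<^bsub>add_monoid A\<^esub> U = \<ominus>\<^bsub>A\<^esub> U" by (simp add: a_inv_def)
      with 4 show ?case by (simp add: A.hom_uminus P_uminus)
    qed (auto simp: A.hom_zero A.hom_add P_zero P_add)
  next
    fix U V assume "U \<in> {U \<in> carrier A. P (frac_val to_fract U)}" and V: "V \<in> carrier A"
    then have U: "U \<in> carrier A" "P (frac_val to_fract U)" by auto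
    have "P (frac_val to_fract V * frac_val to_fract U)"
      using A_elem[OF V] P_mult[OF U(2)] by metis
    then show "V \<otimes>\<^bsub>A\<^esub> U \<in> {U \<in> carrier A. P (frac_val to_fract U)}"
      "U \<otimes>\<^bsub>A\<^esub> V \<in> {U \<in> carrier A. P (frac_val to_fract U)}"
      using U V by (simp_all add: A.hom_mult mult.commute)
  qed
  then show ?thesis unfolding P_def .
qed

text \<open>The converse bound on the radical: the decomposition of \<open>a\<^sup>p\<close> in the polynomial ring is divided by
  \<open>s\<^sup>p\<close>, one term at a time.\<close>

lemma power_mem_params_ideal:
  assumes I: "ideal I A" "set fs \<subseteq> I" and U: "U \<in> carrier A"
    and a: "a \<in> carrier (invariant_ring n)" "Poly_Mapping.lookup a 0 = 0" and s: "s \<in> invariant_denoms n"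
    and U_val: "frac_val to_fract U = to_fract a / to_fract s"
  shows "U [^]\<^bsub>A\<^esub> p \<in> I"
proof -
  interpret I: ideal I A by fact
  obtain i and h :: "_ \<Rightarrow> 'k mpoly"
    where ih: "\<And>m. m \<in> Poly_Mapping.keys a \<Longrightarrow> i m \<in> {1..n} \<and> h m \<in> poly_carrier n"
      and a_power: "a ^ p = (\<Sum>m\<in>Poly_Mapping.keys a. h m ^ p * Var (i m) ^ p)"
    using mpoly_power_char_decomposition[OF char p_pos, of a n] a by (auto simp: carrier_invariants)
  have sp: "s ^ p \<in> invariant_denoms n"
    using denomD[OF s] char_power_invariant[OF char, of s n]
    by (simp add: invariant_denoms_def carrier_invariants constant_term_power)
  have "\<exists>V\<in>I. frac_val to_fract V = (\<Sum>m\<in>M. to_fract (h m ^ p * Var (i m) ^ p)) / to_fract (s ^ p)"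
    if "finite M" "M \<subseteq> Poly_Mapping.keys a" for M
    using that
  proof (induction M)
    case empty
    show ?case using I.zero_closed A.hom_zero by force
  next
    case (insert m M)
    then obtain V where V: "V \<in> I"
      "frac_val to_fract V = (\<Sum>m\<in>M. to_fract (h m ^ p * Var (i m) ^ p)) / to_fract (s ^ p)" by auto
    have im: "i m \<in> {1..n}" "h m \<in> poly_carrier n" using ih[of m] insert.prems by auto
    obtain W where W: "W \<in> carrier A" "frac_val to_fract W = to_fract (h m ^ p) / to_fract (s ^ p)"
      using A_fraction[OF char_power_invariant[OF char im(2)] sp] by blast
    have im': "i m - 1 < n" "Suc (i m - 1) = i m" using im(1) by auto
    then have "fs ! (i m - 1) \<in> set fs" by (intro nth_mem) (simp add: length_fs)
    then have x: "fs ! (i m - 1) \<in> I" "fs ! (i m - 1) \<in> carrier A"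
      "frac_val to_fract (fs ! (i m - 1)) = to_fract (Var (i m)) ^ p"
      using I(2) fs_nth_carrier[OF im'(1)] fs_nth_val[OF im'(1)] unfolding im'(2) by blast+
    have "W \<otimes>\<^bsub>A\<^esub> fs ! (i m - 1) \<oplus>\<^bsub>A\<^esub> V \<in> I"
      using x V W by (intro I.a_closed I.I_l_closed)
    moreover have "frac_val to_fract (W \<otimes>\<^bsub>A\<^esub> fs ! (i m - 1) \<oplus>\<^bsub>A\<^esub> V)
        = (\<Sum>m\<in>insert m M. to_fract (h m ^ p * Var (i m) ^ p)) / to_fract (s ^ p)"
      using x V W insert.hyps I.Icarr[OF V(1)]
      by (simp add: A.hom_add A.hom_mult to_fract_power add_divide_distrib)
    ultimately show ?case by blast
  qed
  from this[of "Poly_Mapping.keys a"] obtain V where V: "V \<in> I"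
    "frac_val to_fract V = (\<Sum>m\<in>Poly_Mapping.keys a. to_fract (h m ^ p * Var (i m) ^ p)) / to_fract (s ^ p)"
    by auto
  have "frac_val to_fract V = to_fract (a ^ p) / to_fract (s ^ p)"
    by (simp only: V(2) a_power to_fract_sum)
  then have "frac_val to_fract (U [^]\<^bsub>A\<^esub> p) = frac_val to_fract V"
    using U U_val by (simp add: A.hom_pow to_fract_power power_divide)
  then have "U [^]\<^bsub>A\<^esub> p = V"
    using U I.Icarr[OF V(1)] by (subst A.eq_iff) auto
  with V show ?thesis by simp
qed

lemma radical_params: "radical_ideal A (genideal A (set fs)) = nonunits A"
proof (intro equalityI subsetI)
  fix U assume U: "U \<in> radical_ideal A (genideal A (set fs))"
  define M where "M = {U \<in> carrier A. \<exists>a s. a \<in> carrier (invariant_ring n) \<and> s \<in> invariant_denoms n \<and>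
     Poly_Mapping.lookup a 0 = 0 \<and> frac_val to_fract U = to_fract a / to_fract s}"
  interpret M: ideal M A unfolding M_def by (rule ideal_of_maximal_ideal)
  have "fs ! i \<in> M" if "i < n" for i
  proof -
    have "Poly_Mapping.lookup (Var (Suc i) ^ p :: 'k mpoly) 0 = 0"
      using p_pos by (simp add: constant_term_power constant_term_Var)
    moreover have "Var (Suc i) ^ p \<in> carrier (invariant_ring n :: 'k mpoly ring)"
      using that by (intro Var_power_invariant) auto
    moreover have "frac_val to_fract (fs ! i) = to_fract (Var (Suc i) ^ p :: 'k mpoly) / to_fract 1"
      using that by (simp add: fs_nth_val to_fract_power)
    ultimately show ?thesis
      unfolding M_def using one_denom fs_nth_carrier[OF that] by blast
  qed
  then have "genideal A (set fs) \<subseteq> M"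
    unfolding set_fs by (intro A.genideal_minimal M.ideal_axioms) blast
  then obtain k :: nat where k: "U [^]\<^bsub>A\<^esub> k \<in> M" and carr: "U \<in> carrier A"
    using U by (auto simp: radical_ideal_def)
  have "U \<notin> Units A"
  proof
    assume "U \<in> Units A"
    then have unit: "U [^]\<^bsub>A\<^esub> k \<in> Units A" by (rule A.Units_pow_closed)
    then have "\<one>\<^bsub>A\<^esub> \<in> M"
      using M.I_l_closed[OF k A.Units_inv_closed[OF unit]] A.Units_l_inv[OF unit] by simp
    then obtain a s :: "'k mpoly" where as: "s \<in> invariant_denoms n" "Poly_Mapping.lookup a 0 = 0"
      "1 = to_fract a / to_fract s"
      unfolding M_def mem_Collect_eq A.hom_one by blast
    have "to_fract a = to_fract s" using as(3) denomD[OF as(1)] by (simp add: eq_divide_eq)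
    then have "a = s" by (simp only: to_fract_eq_iff)
    then show False using as denomD[OF as(1)] by blast
  qed
  with carr show "U \<in> nonunits A" by (simp add: nonunits_def)
next
  fix U assume U: "U \<in> nonunits A"
  then have carr: "U \<in> carrier A" and not_unit: "U \<notin> Units A" by (auto simp: nonunits_def)
  obtain a s where as: "a \<in> carrier (invariant_ring n)" "s \<in> invariant_denoms n"
    "frac_val to_fract U = to_fract a / to_fract s"
    using carr by (rule A_elem)
  have "Poly_Mapping.lookup a 0 = 0"
  proof (rule ccontr)
    assume "Poly_Mapping.lookup a 0 \<noteq> 0"
    then have a: "a \<in> invariant_denoms n" using as by (simp add: invariant_denoms_def)
    obtain V where V: "V \<in> carrier A" "frac_val to_fract V = to_fract s / to_fract a"
      using A_fraction[of s a] denomD[OF as(2)] a by blast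
    have "U \<otimes>\<^bsub>A\<^esub> V = \<one>\<^bsub>A\<^esub>"
      using carr V denomD[OF as(2)] denomD[OF a] as(3) by (subst A.eq_iff) (simp_all add: A.hom_mult A.hom_one)
    then show False
      using not_unit carr V(1) A.m_comm[OF carr V(1)] by (auto simp: Units_def)
  qed
  then have "U [^]\<^bsub>A\<^esub> p \<in> genideal A (set fs)"
    using power_mem_params_ideal[OF A.genideal_ideal[OF C.fs_carrier] A.genideal_self[OF C.fs_carrier] carr
        as(1) _ as(2,3)] by blast
  with carr show "U \<in> radical_ideal A (genideal A (set fs))"
    by (auto simp: radical_ideal_def)
qed

text \<open>Numerator and denominator are multiplied by \<open>x\<^sub>i\<^sup>p\<close> once more, so that \<open>N > 0\<close>; then \<open>x\<^sub>i\<^bsup>N-1\<^esup>\<close> makes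
  sense and \<open>\<partial>\<close> can be applied to it.\<close>

lemma cech_vals_vertex:
  assumes i: "i < n" and r: "r \<in> C.cech_vals {i}"
  obtains a s N where "a \<in> carrier (invariant_ring n)" "s \<in> invariant_denoms n" "N > 0" "(of_nat N :: 'k mpoly) = 0"
    "r = to_fract a / (to_fract s * to_fract (Var (Suc i)) ^ N)"
proof -
  obtain U and e :: "nat \<Rightarrow> nat" where U: "U \<in> carrier A" "r = frac_val to_fract U / frac_val to_fract (fs ! i) ^ e i"
    using r i by (subst (asm) C.cech_vals_eq) (auto simp: length_fs)
  obtain a s where as: "a \<in> carrier (invariant_ring n)" "s \<in> invariant_denoms n"
    "frac_val to_fract U = to_fract a / to_fract s"
    using U(1) by (rule A_elem)
  let ?x = "to_fract (Var (Suc i) :: 'k mpoly)"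
  have "r = to_fract a / (to_fract s * ?x ^ (p * e i))"
    by (simp add: U(2) as fs_nth_val[OF i] power_mult)
  also have "\<dots> = to_fract (a * Var (Suc i) ^ p) / (to_fract s * ?x ^ (p * Suc (e i)))"
    using to_fract_Var_nonzero[of "Suc i"] by (simp add: to_fract_power power_add)
  finally have "r = to_fract (a * Var (Suc i) ^ p) / (to_fract s * ?x ^ (p * Suc (e i)))" .
  moreover have "(of_nat (p * Suc (e i)) :: 'k mpoly) = 0"
    using of_nat_CHAR[where 'a = "'k mpoly"] by (simp add: CHAR_mpoly char)
  moreover have "a * Var (Suc i) ^ p \<in> carrier (invariant_ring n)"
    using as(1) Var_power_invariant[of "Suc i"] i by (intro invariants_mult) auto
  ultimately show ?thesis
    using that[of "a * Var (Suc i) ^ p" s "p * Suc (e i)"] as(2) p_pos by simp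
qed

lemma H2_not_injective:
  assumes "n \<ge> 2"
  shows "\<not> inj_on (frobenius_action p A fs 2) (carrier (local_cohomology A fs 2))"
proof (rule C.second_cohomology_not_injective[of "\<lambda>i. 1 / to_fract (Var (Suc i))"])
  fix i j assume ij: "i < j" "j < length fs"
  then have less: "i < n" "j < n" by (simp_all add: length_fs)
  let ?x = "Var (Suc i) :: 'k mpoly" and ?y = "Var (Suc j) :: 'k mpoly"
  have char0: "(of_nat p :: 'k mpoly) = 0"
    using of_nat_CHAR[where 'a = "'k mpoly"] by (simp add: CHAR_mpoly char)
  \<comment> \<open>The numerator of \<open>1/y - 1/x\<close> over \<open>x\<^sup>p y\<^sup>p\<close>; its two terms have the same derivative \<open>- x\<^sup>p y\<^sup>p\<close>.\<close>
  define b where "b = ?x ^ p * ?y ^ (p - 1) - ?x ^ (p - 1) * ?y ^ p"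
  have inv: "square_derivation n (?x ^ p) = 0" "square_derivation n (?y ^ p) = 0"
    using Var_power_invariant[of "Suc i"] Var_power_invariant[of "Suc j"] less by (auto simp: carrier_invariants)
  have pred: "square_derivation n (?x ^ (p - 1)) = - (?x ^ p)" "square_derivation n (?y ^ (p - 1)) = - (?y ^ p)"
    using less by (auto intro!: square_derivation_Var_power_pred[OF _ char0 p_pos] simp del: One_nat_def)
  have "square_derivation n b = 0"
    unfolding b_def square_derivation_diff square_derivation_mult inv pred by simp
  moreover have "b \<in> poly_carrier n"
    using less poly_carrier_add[OF _ poly_carrier_uminus, of "?x ^ p * ?y ^ (p - 1)" n "?x ^ (p - 1) * ?y ^ p"]
    by (simp add: b_def poly_carrier_mult poly_carrier_power poly_carrier_Var)
  ultimately have "b \<in> carrier (invariant_ring n)" by (simp add: carrier_invariants)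
  then obtain U where U: "U \<in> carrier A" "frac_val to_fract U = to_fract b"
    using A_fraction[OF _ one_denom] by (metis div_by_1 to_fract_1)
  have nonzero: "to_fract ?x \<noteq> 0" "to_fract ?y \<noteq> 0" by (rule to_fract_Var_nonzero)+
  obtain q where q: "p = Suc q" using p_pos by (cases p) auto
  have "1 / to_fract ?y - 1 / to_fract ?x = to_fract b / (to_fract ?x ^ p * to_fract ?y ^ p)"
    using nonzero by (simp add: b_def q to_fract_power field_simps)
  also have "\<dots> = frac_val to_fract U / (\<Prod>k\<in>{i, j}. frac_val to_fract (fs ! k) ^ 1)"
    using ij less by (simp add: U fs_nth_val)
  finally have "1 / to_fract ?y - 1 / to_fract ?x
      = frac_val to_fract U / (\<Prod>k\<in>{i, j}. frac_val to_fract (fs ! k) ^ 1)" .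
  moreover have "{i, j} \<subseteq> {..<length fs}" using ij by simp
  ultimately show "1 / to_fract ?y - 1 / to_fract ?x \<in> C.cech_vals {i, j}"
    using U(1) by (subst C.cech_vals_eq) (auto simp only: intro!: exI[of _ U] exI[of _ "\<lambda>_. 1"])
next
  fix i assume "i < length fs"
  then have i: "i < n" by (simp add: length_fs)
  have "(1 / to_fract (Var (Suc i) :: 'k mpoly)) ^ p = frac_val to_fract \<one>\<^bsub>A\<^esub> / (\<Prod>k\<in>{i}. frac_val to_fract (fs ! k) ^ 1)"
    using i by (simp add: A.hom_one fs_nth_val power_one_over)
  then show "(1 / to_fract (Var (Suc i) :: 'k mpoly)) ^ p \<in> C.cech_vals {i}"
    using i by (subst C.cech_vals_eq) (auto simp: length_fs intro!: exI[of _ "\<one>\<^bsub>A\<^esub>"] exI[of _ "\<lambda>_. 1"])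
next
  fix r assume r: "\<And>i. i < length fs \<Longrightarrow> r i \<in> C.cech_vals {i}"
    and eq: "\<And>i j. \<lbrakk>i < j; j < length fs\<rbrakk> \<Longrightarrow>
      1 / to_fract (Var (Suc j) :: 'k mpoly) - 1 / to_fract (Var (Suc i)) = r j - r i"
  obtain a s N where a: "a \<in> carrier (invariant_ring n)" "s \<in> invariant_denoms n" "N > 0" "(of_nat N :: 'k mpoly) = 0"
    "r 0 = to_fract a / (to_fract s * to_fract (Var 1) ^ N)"
    using cech_vals_vertex[of 0 "r 0"] r[of 0] \<open>n \<ge> 2\<close> by (auto simp: length_fs)
  obtain b t M where b: "b \<in> carrier (invariant_ring n)" "t \<in> invariant_denoms n" "M > 0" "(of_nat M :: 'k mpoly) = 0"
    "r 1 = to_fract b / (to_fract t * to_fract (Var 2) ^ M)"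
    using cech_vals_vertex[of 1 "r 1"] r[of 1] \<open>n \<ge> 2\<close> by (auto simp: length_fs numeral_2_eq_2)
  have "1 / to_fract (Var 1 :: 'k mpoly) - r 0 = 1 / to_fract (Var 2) - r 1"
    using eq[of 0 1] \<open>n \<ge> 2\<close> by (simp add: length_fs numeral_2_eq_2 algebra_simps)
  then have "(to_fract s * to_fract (Var 1) ^ (N - 1) - to_fract a) * (to_fract t * to_fract (Var 2) ^ M)
      = (to_fract t * to_fract (Var 2) ^ (M - 1) - to_fract b) * (to_fract s * to_fract (Var 1) ^ N)"
    using a b denomD[OF a(2)] denomD[OF b(2)] to_fract_Var_nonzero
    by (intro clear_denominators) auto
  then have "(s * Var 1 ^ (N - 1) - a) * (t * Var 2 ^ M) = (t * Var 2 ^ (M - 1) - b) * (s * Var 1 ^ N)"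
    by (simp only: to_fract_power[symmetric] to_fract_mult[symmetric] to_fract_diff[symmetric] to_fract_eq_iff)
  then have "Poly_Mapping.lookup (s * t) 0 = 0"
    using a b denomD[OF a(2)] denomD[OF b(2)] \<open>n \<ge> 2\<close>
    by (intro no_common_fraction[of 1 n 2 N s t a M b]) (auto simp: carrier_invariants)
  then show False
    using denomD[OF a(2)] denomD[OF b(2)] by (simp add: constant_term_mult)
qed

end

theorem mainTheorem9:
  fixes p n :: nat
  assumes "CHAR('k::alg_closed_field) = p" and "p > 0" and "n \<ge> 2"
  shows "\<not> F_injective p
           (quotient_local_ring n (square_derivation n :: 'k mpoly \<Rightarrow> 'k mpoly))"
proof
  let ?A = "quotient_local_ring n (square_derivation n :: 'k mpoly \<Rightarrow> 'k mpoly)"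
  let ?fs = "frobenius_params p n :: ('k mpoly \<times> 'k mpoly) set list"
  assume "F_injective p ?A"
  moreover have "set ?fs \<subseteq> carrier ?A"
    using cech_embedding_A[OF assms(1,2), of n]
    by (simp add: cech_embedding_char_def cech_embedding_def cech_embedding_axioms_def)
  moreover have "radical_ideal ?A (genideal ?A (set ?fs)) = nonunits ?A"
    by (rule radical_params[OF assms(1,2)])
  ultimately have "inj_on (frobenius_action p ?A ?fs 2) (carrier (local_cohomology ?A ?fs 2))"
    unfolding F_injective_def by blast
  then show False using H2_not_injective[OF assms] by blast
qed

end
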